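(* Let $M\ge1$, let $P$ be the Lebesgue measure on $S=\mathbb{R}$, let $X=\mathbb{R}$ and $\psi(x,s)=e^{-(x-s)^2}$. Then, in the reconstruction framework defined by $P$ and $\psi$: (1) Any measure $m_0=\sum_{i=1}^Ma_i\delta_{x_i}$, with $x_1<\dots<x_M$ in $\mathbb{R}$ and $a_i>0$ for all $i$, satisfies the Non-Degenerate Source Condition. (2) Any point $x_0\in\mathbb{R}$ is $(2M-1)$ Non Degenerate.
   Context: The reconstruction framework defined by $P$ and $\psi$ is: $H=L^2(S,P)$ and $\varphi:X\to H$, $\varphi(x)=\psi(x,\cdot)$. $C_0(X)$ is the space of continuous functions $\eta:X\to\mathbb{R}$ such that for every $\varepsilon>0$ there is a compact $K\subset X$ with $|\eta|\le\varepsilon$ on $X\setminus K$. For $k\in\mathbb{N}$, $\mathcal{K}^k(X;H)$ is the set of $\varphi\in C^k(X;H)$ such that $x\mapsto\langle p,\varphi(x)\rangle_H$ belongs to $C_0(X)$ for all $p\in H$ and $\sup_{x\in X}\|\varphi^{(i)}(x)\|_H<\infty$ for $0\le i\le k$. For $p\in H$, $(\Phi^*p)(x)=\langle\varphi(x),p\rangle_H$. $\Gamma_x:\mathbb{R}^{2M}\to H$ is $\Gamma_xb=\sum_{i=1}^M(b_{2i-1}\varphi(x_i)+b_{2i}\varphi'(x_i))$. If $\Gamma_x$ has full rank (is injective), $p_V$ is the element of minimal norm of $\{p\in H:(\Phi^*p)(x_i)=1,\ (\Phi^*p)'(x_i)=0,\ 1\le i\le M\}$ and $\eta_V=\Phi^*p_V$.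 The measure $m_0$ satisfies the Non-Degenerate Source Condition if $\Gamma_x$ has full rank, $\eta_V(x)<1$ for all $x\in X\setminus\{x_1,\dots,x_M\}$, and $\eta_V''(x_i)<0$ for all $1\le i\le M$. $F_{2M-1}:\mathbb{R}^{2M}\to H$ is $F_{2M-1}b=\sum_{k=0}^{2M-1}b_{k+1}\varphi^{(k)}(x_0)$. If it has full rank (is injective), $p_W$ is the element of minimal norm of $\{p\in H:(\Phi^*p)(x_0)=1,\ (\Phi^*p)^{(k)}(x_0)=0,\ 1\le k\le2M-1\}$ and $\eta_W=\Phi^*p_W$. The point $x_0$ is $(2M-1)$ Non Degenerate if $\varphi\in\mathcal{K}^{2M}(X;H)$, $F_{2M-1}$ has full rank, $\eta_W^{(2M)}(x_0)<0$, and $\eta_W(x)<1$ for all $x\in X\setminus\{x_0\}$. *)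

theory Defs
  imports "HOL-Analysis.Analysis" "HOL-Probability.Distributions"
begin

text \<open>Borel representatives suffice: every Lebesgue measurable function agrees almost everywhere
  with a Borel function, so \<open>L2\<close> below is the usual space of classes.\<close>

definition square_integrable :: "(real \<Rightarrow> real) \<Rightarrow> bool" where
  "square_integrable f \<longleftrightarrow> f \<in> borel_measurable lborel \<and> integrable lborel (\<lambda>s. (f s)\<^sup>2)"

definition L2_rel :: "(real \<Rightarrow> real) \<Rightarrow> (real \<Rightarrow> real) \<Rightarrow> bool" where
  "L2_rel f g \<longleftrightarrow> square_integrable f \<and> square_integrable g \<and> (AE s in lborel. f s = g s)"

lemma square_integrable_zero: "square_integrable (\<lambda>s. 0)"
  by (simp add: square_integrable_def)

lemma square_integrable_mult:
  assumes "square_integrable f" "square_integrable g"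
  shows "integrable lborel (\<lambda>s. f s * g s)"
proof (rule Bochner_Integration.integrable_bound)
  show "integrable lborel (\<lambda>s. (f s)\<^sup>2 + (g s)\<^sup>2)"
    using assms by (simp add: square_integrable_def)
  show "(\<lambda>s. f s * g s) \<in> borel_measurable lborel"
    using assms unfolding square_integrable_def by (blast intro: borel_measurable_times)
  have "\<bar>u * v\<bar> \<le> u\<^sup>2 + v\<^sup>2" for u v :: real
  proof -
    have "2 * \<bar>u * v\<bar> \<le> u\<^sup>2 + v\<^sup>2"
      using sum_squares_bound[of "\<bar>u\<bar>" "\<bar>v\<bar>"] by (simp add: abs_mult mult.assoc)
    then show ?thesis by linarith
  qed
  then show "AE s in lborel. norm (f s * g s) \<le> norm ((f s)\<^sup>2 + (g s)\<^sup>2)"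
    by simp
qed

lemma square_integrable_add:
  assumes "square_integrable f" "square_integrable g"
  shows "square_integrable (\<lambda>s. f s + g s)"
  using assms square_integrable_mult[OF assms]
  by (auto simp: square_integrable_def power2_sum mult.assoc)

lemma square_integrable_scale:
  assumes "square_integrable f"
  shows "square_integrable (\<lambda>s. c * f s)"
  using assms by (auto simp: square_integrable_def power_mult_distrib)

quotient_type L2 = "real \<Rightarrow> real" / partial: L2_rel
proof (rule part_equivpI)
  show "\<exists>f. L2_rel f f"
    using square_integrable_zero by (auto simp: L2_rel_def)
  show "symp L2_rel"
    by (auto simp: symp_def L2_rel_def elim: AE_mp)
  show "transp L2_rel"
    by (auto simp: transp_def L2_rel_def elim: AE_mp)
qed

instantiation L2 :: real_inner
begin

lift_definition zero_L2 :: L2 is "\<lambda>s. 0"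
  by (simp add: L2_rel_def square_integrable_zero)

lift_definition plus_L2 :: "L2 \<Rightarrow> L2 \<Rightarrow> L2" is "\<lambda>f g s. f s + g s"
  by (auto simp: L2_rel_def square_integrable_add elim: AE_mp)

lift_definition scaleR_L2 :: "real \<Rightarrow> L2 \<Rightarrow> L2" is "\<lambda>c f s. c * f s"
  by (auto simp: L2_rel_def square_integrable_scale elim: AE_mp)

definition uminus_L2 :: "L2 \<Rightarrow> L2" where "uminus_L2 p = (-1) *\<^sub>R p"
definition minus_L2 :: "L2 \<Rightarrow> L2 \<Rightarrow> L2" where "minus_L2 p q = p + - q"

lift_definition inner_L2 :: "L2 \<Rightarrow> L2 \<Rightarrow> real" is "\<lambda>f g. LINT s|lborel. f s * g s"
  by (rule integral_cong_AE) (auto simp: L2_rel_def square_integrable_def elim: AE_mp)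

definition norm_L2 :: "L2 \<Rightarrow> real" where "norm_L2 p = sqrt (inner p p)"
definition dist_L2 :: "L2 \<Rightarrow> L2 \<Rightarrow> real" where "dist_L2 p q = norm (p - q)"
definition sgn_L2 :: "L2 \<Rightarrow> L2" where "sgn_L2 p = inverse (norm p) *\<^sub>R p"
definition uniformity_L2 :: "(L2 \<times> L2) filter" where
  "uniformity_L2 = (INF e\<in>{0<..}. principal {(p, q). dist p q < e})"
definition open_L2 :: "L2 set \<Rightarrow> bool" where
  "open_L2 U \<longleftrightarrow> (\<forall>p\<in>U. \<forall>\<^sub>F (p', q) in uniformity. p' = p \<longrightarrow> q \<in> U)"

instance
proof
  fix p q r :: L2 and c d :: real
  show "p + q + r = p + (q + r)"
    by transfer (auto simp: L2_rel_def square_integrable_add algebra_simps)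
  show "p + q = q + p"
    by transfer (auto simp: L2_rel_def square_integrable_add algebra_simps)
  show "0 + p = p"
    by transfer (auto simp: L2_rel_def)
  show "- p + p = 0"
    unfolding uminus_L2_def
    by transfer (auto simp: L2_rel_def square_integrable_zero)
  show "p - q = p + - q" by (rule minus_L2_def)
  show "c *\<^sub>R (p + q) = c *\<^sub>R p + c *\<^sub>R q"
    by transfer (auto simp: L2_rel_def square_integrable_add square_integrable_scale algebra_simps)
  show "(c + d) *\<^sub>R p = c *\<^sub>R p + d *\<^sub>R p"
    by transfer (auto simp: L2_rel_def square_integrable_add square_integrable_scale distrib_right
        simp flip: distrib_right)
  show "c *\<^sub>R d *\<^sub>R p = (c * d) *\<^sub>R p"
    by transfer (auto simp: L2_rel_def square_integrable_scale mult.assoc simp flip: mult.assoc)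
  show "1 *\<^sub>R p = p"
    by transfer (auto simp: L2_rel_def)
  show "dist p q = norm (p - q)" by (rule dist_L2_def)
  show "sgn p = inverse (norm p) *\<^sub>R p" by (rule sgn_L2_def)
  show "uniformity = (INF e\<in>{0<..}. principal {(p, q :: L2). dist p q < e})"
    by (rule uniformity_L2_def)
  show "open U \<longleftrightarrow> (\<forall>p\<in>U. \<forall>\<^sub>F (p', q) in uniformity. p' = p \<longrightarrow> q \<in> U)" for U :: "L2 set"
    by (rule open_L2_def)
  show "inner p q = inner q p"
    by transfer (simp add: mult.commute)
  show "inner (p + q) r = inner p r + inner q r"
    by transfer (simp add: L2_rel_def distrib_right square_integrable_mult)
  show "inner (c *\<^sub>R p) q = c * inner p q"
    by transfer (simp add: mult.assoc)
  show "0 \<le> inner p p"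
    by transfer simp
  show "inner p p = 0 \<longleftrightarrow> p = 0"
  proof transfer
    fix f assume f: "L2_rel f f"
    then have "integrable lborel (\<lambda>s. f s * f s)"
      by (simp add: L2_rel_def square_integrable_mult)
    then have "(LINT s|lborel. f s * f s) = 0 \<longleftrightarrow> (AE s in lborel. f s * f s = 0)"
      by (rule integral_nonneg_eq_0_iff_AE) simp
    then show "(LINT s|lborel. f s * f s) = 0 \<longleftrightarrow> L2_rel f (\<lambda>s. 0)"
      using f by (simp add: L2_rel_def square_integrable_zero)
  qed
  show "norm p = sqrt (inner p p)" by (rule norm_L2_def)
qed

end

lemma inner_abs_L2:
  assumes "square_integrable f" "square_integrable g"
  shows "inner (abs_L2 f) (abs_L2 g) = (LINT s|lborel. f s * g s)"
  using assms by (simp add: inner_L2.abs_eq L2_rel_def)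

definition iter_deriv :: "nat \<Rightarrow> (real \<Rightarrow> 'h::real_normed_vector) \<Rightarrow> real \<Rightarrow> 'h" where
  "iter_deriv k \<phi> = ((\<lambda>f x. vector_derivative f (at x)) ^^ k) \<phi>"

definition C_k :: "nat \<Rightarrow> (real \<Rightarrow> 'h::real_normed_vector) set" where
  "C_k k = {\<phi>. (\<forall>i<k. \<forall>x. iter_deriv i \<phi> differentiable (at x)) \<and>
                continuous_on UNIV (iter_deriv k \<phi>)}"

definition C_0 :: "('a::topological_space \<Rightarrow> real) set" where
  "C_0 = {\<eta>. continuous_on UNIV \<eta> \<and>
             (\<forall>\<epsilon>>0. \<exists>K. compact K \<and> (\<forall>x\<in>-K. \<bar>\<eta> x\<bar> \<le> \<epsilon>))}"

definition K_k :: "nat \<Rightarrow> (real \<Rightarrow> 'h::real_inner) set" where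
  "K_k k = {\<phi> \<in> C_k k. (\<forall>p. (\<lambda>x. inner p (\<phi> x)) \<in> C_0) \<and>
                        (\<forall>i\<le>k. bdd_above (range (\<lambda>x. norm (iter_deriv i \<phi> x))))}"

definition Phi_adj :: "(real \<Rightarrow> 'h::real_inner) \<Rightarrow> 'h \<Rightarrow> real \<Rightarrow> real" where
  "Phi_adj \<phi> p x = inner (\<phi> x) p"

definition min_norm_elt :: "'h::real_normed_vector set \<Rightarrow> 'h" where
  "min_norm_elt A = (THE p. is_arg_min norm (\<lambda>q. q \<in> A) p)"

text \<open>Extensional functions encode \<open>\<real>\<^sup>n\<close> with coordinates indexed from 1; injectivity of a map on
  \<open>Rn n\<close> then only involves these \<open>n\<close> coordinates.\<close>

definition Rn :: "nat \<Rightarrow> (nat \<Rightarrow> real) set" where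
  "Rn n = {1..n} \<rightarrow>\<^sub>E UNIV"

definition Gamma :: "(real \<Rightarrow> 'h::real_inner) \<Rightarrow> nat \<Rightarrow> (nat \<Rightarrow> real) \<Rightarrow> (nat \<Rightarrow> real) \<Rightarrow> 'h" where
  "Gamma \<phi> M x b =
     (\<Sum>i=1..M. b (2 * i - 1) *\<^sub>R \<phi> (x i) + b (2 * i) *\<^sub>R iter_deriv 1 \<phi> (x i))"

definition p_V :: "(real \<Rightarrow> 'h::real_inner) \<Rightarrow> nat \<Rightarrow> (nat \<Rightarrow> real) \<Rightarrow> 'h" where
  "p_V \<phi> M x =
     min_norm_elt {p. \<forall>i\<in>{1..M}. Phi_adj \<phi> p (x i) = 1 \<and> deriv (Phi_adj \<phi> p) (x i) = 0}"

definition eta_V :: "(real \<Rightarrow> 'h::real_inner) \<Rightarrow> nat \<Rightarrow> (nat \<Rightarrow> real) \<Rightarrow> real \<Rightarrow> real" where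
  "eta_V \<phi> M x = Phi_adj \<phi> (p_V \<phi> M x)"

definition nondegenerate_support ::
  "(real \<Rightarrow> 'h::real_inner) \<Rightarrow> nat \<Rightarrow> (nat \<Rightarrow> real) \<Rightarrow> bool" where
  "nondegenerate_support \<phi> M x \<longleftrightarrow>
     inj_on (Gamma \<phi> M x) (Rn (2 * M)) \<and>
     (\<forall>y. y \<notin> x ` {1..M} \<longrightarrow> eta_V \<phi> M x y < 1) \<and>
     (\<forall>i\<in>{1..M}. (deriv ^^ 2) (eta_V \<phi> M x) (x i) < 0)"

text \<open>The measure \<open>\<Sum>i=1..M. a i \<cdot> \<delta>(x i)\<close>, as a pushforward of a weighted counting measure.\<close>

definition spikes :: "nat \<Rightarrow> (nat \<Rightarrow> real) \<Rightarrow> (nat \<Rightarrow> real) \<Rightarrow> real measure" where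
  "spikes M a x = distr (point_measure {1..M} (\<lambda>i. ennreal (a i))) borel x"

lemma emeasure_spikes:
  assumes "A \<in> sets borel"
  shows "emeasure (spikes M a x) A = (\<Sum>i=1..M. ennreal (a i) * indicator A (x i))"
proof -
  have "emeasure (spikes M a x) A = emeasure (point_measure {1..M} (\<lambda>i. ennreal (a i))) (x -` A \<inter> {1..M})"
    unfolding spikes_def using assms by (subst emeasure_distr) (auto simp: space_point_measure)
  also have "\<dots> = (\<Sum>i\<in>x -` A \<inter> {1..M}. ennreal (a i))"
    by (rule emeasure_point_measure_finite) auto
  also have "\<dots> = (\<Sum>i=1..M. ennreal (a i) * indicator A (x i))"
    by (rule sum.mono_neutral_cong_left) (auto simp: indicator_def)
  finally show ?thesis .
qed

definition NDSC :: "(real \<Rightarrow> 'h::real_inner) \<Rightarrow> real measure \<Rightarrow> bool" where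
  "NDSC \<phi> m \<longleftrightarrow>
     (\<exists>M a x. strict_mono_on {1..M} x \<and> (\<forall>i\<in>{1..M}. 0 < a i) \<and> m = spikes M a x \<and>
              nondegenerate_support \<phi> M x)"

text \<open>The decomposition in the previous definition is unique, so the condition does not depend on
  the choice of \<open>M\<close>, \<open>a\<close>, \<open>x\<close>.\<close>

lemma support_spikes:
  assumes "\<forall>i\<in>{1..M}. 0 < a i"
  shows "{t. emeasure (spikes M a x) {t} \<noteq> 0} = x ` {1..M}"
proof (rule set_eqI)
  fix t
  have "emeasure (spikes M a x) {t} = 0 \<longleftrightarrow>
      (\<forall>i\<in>{1..M}. ennreal (a i) * indicator {t} (x i) = 0)"
    by (subst emeasure_spikes, simp, subst sum_nonneg_eq_0_iff) simp_all
  also have "\<dots> \<longleftrightarrow> (\<forall>i\<in>{1..M}. x i \<noteq> t)"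
  proof (rule ball_cong)
    fix i assume "i \<in> {1..M}"
    then have "0 < a i" using assms by blast
    then show "ennreal (a i) * indicator {t} (x i) = 0 \<longleftrightarrow> x i \<noteq> t"
      by (simp add: indicator_def ennreal_eq_0_iff)
  qed simp
  finally show "t \<in> {t. emeasure (spikes M a x) {t} \<noteq> 0} \<longleftrightarrow> t \<in> x ` {1..M}"
    by blast
qed

lemma spikes_eqD:
  assumes "strict_mono_on {1..M} x" "\<forall>i\<in>{1..M}. 0 < a i"
    and "strict_mono_on {1..N} y" "\<forall>i\<in>{1..N}. 0 < b i"
    and eq: "spikes M a x = spikes N b y"
  shows "M = N \<and> (\<forall>i\<in>{1..M}. x i = y i)"
proof -
  have im: "x ` {1..M} = y ` {1..N}"
    using assms support_spikes by metis
  have srt: "sorted (map z [1..<Suc n]) \<and> distinct (map z [1..<Suc n])"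
    if "strict_mono_on {1..n} z" for z :: "nat \<Rightarrow> real" and n
  proof
    show "distinct (map z [1..<Suc n])"
      using strict_mono_on_imp_inj_on[OF that]
      by (simp add: distinct_map atLeastLessThanSuc_atLeastAtMost del: upt_Suc)
    show "sorted (map z [1..<Suc n])"
      using strict_mono_on_leD[OF that]
      by (auto simp: sorted_iff_nth_mono nth_append simp del: upt_Suc)
  qed
  have l: "map x [1..<Suc M] = map y [1..<Suc N]"
    using srt[OF assms(1)] srt[OF assms(3)] im
    by (intro sorted_distinct_set_unique)
       (auto simp: atLeastLessThanSuc_atLeastAtMost simp del: upt_Suc)
  then have "M = N"
    by (metis diff_Suc_1 length_map length_upt)
  with l show ?thesis
    by (simp add: map_eq_conv atLeastLessThanSuc_atLeastAtMost del: upt_Suc)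
qed

lemma nondegenerate_support_cong:
  assumes "\<And>i. i \<in> {1..M} \<Longrightarrow> x i = y i"
  shows "nondegenerate_support \<phi> M x \<longleftrightarrow> nondegenerate_support \<phi> M y"
proof -
  have "Gamma \<phi> M x = Gamma \<phi> M y"
    unfolding Gamma_def fun_eq_iff using assms by (auto intro!: sum.cong)
  moreover have "p_V \<phi> M x = p_V \<phi> M y"
    unfolding p_V_def using assms by simp
  moreover have "x ` {1..M} = y ` {1..M}"
    using assms by (intro image_cong) auto
  ultimately show ?thesis
    unfolding nondegenerate_support_def eta_V_def using assms by simp
qed

lemma NDSC_spikes_iff:
  assumes "strict_mono_on {1..M} x" "\<forall>i\<in>{1..M}. 0 < a i"
  shows "NDSC \<phi> (spikes M a x) \<longleftrightarrow> nondegenerate_support \<phi> M x"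
proof
  assume "NDSC \<phi> (spikes M a x)"
  then obtain N b y where *: "strict_mono_on {1..N} y" "\<forall>i\<in>{1..N}. 0 < b i"
      "spikes M a x = spikes N b y" and nd: "nondegenerate_support \<phi> N y"
    unfolding NDSC_def by blast
  from spikes_eqD[OF assms *] have "M = N" "\<And>i. i \<in> {1..M} \<Longrightarrow> x i = y i" by auto
  with nd nondegenerate_support_cong show "nondegenerate_support \<phi> M x" by metis
next
  assume "nondegenerate_support \<phi> M x"
  with assms show "NDSC \<phi> (spikes M a x)" unfolding NDSC_def by blast
qed

definition F_map :: "(real \<Rightarrow> 'h::real_inner) \<Rightarrow> nat \<Rightarrow> real \<Rightarrow> (nat \<Rightarrow> real) \<Rightarrow> 'h" where
  "F_map \<phi> n x0 b = (\<Sum>k=0..n. b (k + 1) *\<^sub>R iter_deriv k \<phi> x0)"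

definition p_W :: "(real \<Rightarrow> 'h::real_inner) \<Rightarrow> nat \<Rightarrow> real \<Rightarrow> 'h" where
  "p_W \<phi> M x0 =
     min_norm_elt {p. Phi_adj \<phi> p x0 = 1 \<and>
                      (\<forall>k\<in>{1..2 * M - 1}. (deriv ^^ k) (Phi_adj \<phi> p) x0 = 0)}"

definition eta_W :: "(real \<Rightarrow> 'h::real_inner) \<Rightarrow> nat \<Rightarrow> real \<Rightarrow> real \<Rightarrow> real" where
  "eta_W \<phi> M x0 = Phi_adj \<phi> (p_W \<phi> M x0)"

text \<open>This is the notion called \<open>(2M - 1)\<close> non degenerate; the parameter is \<open>M\<close>.\<close>

definition nondegenerate_point :: "(real \<Rightarrow> 'h::real_inner) \<Rightarrow> nat \<Rightarrow> real \<Rightarrow> bool" where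
  "nondegenerate_point \<phi> M x0 \<longleftrightarrow>
     \<phi> \<in> K_k (2 * M) \<and>
     inj_on (F_map \<phi> (2 * M - 1) x0) (Rn (2 * M)) \<and>
     (deriv ^^ (2 * M)) (eta_W \<phi> M x0) x0 < 0 \<and>
     (\<forall>y. y \<noteq> x0 \<longrightarrow> eta_W \<phi> M x0 y < 1)"

text \<open>\<^const>\<open>abs_L2\<close> sends a function to its class modulo equality almost everywhere. It is
  meaningful only on square-integrable functions, hence the lemma on the Gaussian kernel below.\<close>

definition framework :: "(real \<Rightarrow> real \<Rightarrow> real) \<Rightarrow> real \<Rightarrow> L2" where
  "framework \<psi> x = abs_L2 (\<psi> x)"

definition gaussian :: "real \<Rightarrow> real \<Rightarrow> real" where
  "gaussian x s = exp (- ((x - s)\<^sup>2))"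

lemma square_integrable_gaussian: "square_integrable (gaussian x)"
proof -
  have "integrable lborel (\<lambda>s. sqrt (pi / 2) * normal_density x (1 / 2) s)"
    by (intro integrable_mult_right) simp
  also have "(\<lambda>s. sqrt (pi / 2) * normal_density x (1 / 2) s) = (\<lambda>s. (gaussian x s)\<^sup>2)"
    by (auto simp: fun_eq_iff normal_density_def gaussian_def power2_eq_square field_simps
        simp flip: exp_add)
  finally show ?thesis
    by (simp add: square_integrable_def gaussian_def[abs_def])
qed

end

theory Submission
  imports Defs "HOL-Computational_Algebra.Polynomial" "HOL-Real_Asymp.Real_Asymp"
begin

text \<open>Both certificates lie in the span of derivatives of \<open>\<phi>\<close> at the nodes, hence have the form
  \<open>\<eta> y = \<Sum>i. q i y \<cdot> exp (- (y - x i)\<^sup>2 / 2)\<close> with \<open>q i\<close> a polynomial of degree smaller than the (even)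
  multiplicity of the node \<open>x i\<close>. Let \<open>n\<close> be the total multiplicity. Applying to \<open>1 - \<eta>\<close> the operators
  \<open>g \<mapsto> g' + (y - a) g\<close>, with \<open>a\<close> running through the nodes with multiplicity, annihilates \<open>\<eta>\<close>,
  while \<open>1\<close>, being a multiple of \<open>exp (y\<^sup>2 / 2) \<cdot> \<integral> exp (- (y - s)\<^sup>2) exp (- s\<^sup>2) ds\<close>, becomes the same
  integral with the integrand multiplied by \<open>\<Prod>a. (2 s - a)\<close>. This product is a square, so the
  result is positive. By Rolle's theorem \<open>1 - \<eta>\<close> has at most \<open>n\<close> zeros with
  multiplicity, so the prescribed zeros are all of them and have exactly the prescribed even order.
  Since \<open>\<eta>\<close> tends to 0 at infinity, \<open>1 - \<eta>\<close> is positive elsewhere.\<close>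

subsection \<open>Polynomial multiples of the Gaussian in \<open>L2\<close>\<close>

text \<open>The exponent is split in halves: one \<open>c / 2\<close> bounds the tail
  \<open>q\<close>, the other absorbs the factor \<open>u\<close>. Hence the induction must range
  over all \<open>c\<close>.\<close>

lemma poly_le_exp_sq:
  fixes q :: "real poly" and c :: real
  assumes "0 < c"
  shows "\<exists>K\<ge>0. \<forall>u. \<bar>poly q u\<bar> \<le> K * exp (c * u\<^sup>2)"
  using assms
proof (induction q arbitrary: c)
  case 0
  then show ?case by (intro exI[of _ 0]) simp
next
  case (pCons a q)
  from pCons.IH[of "c / 2"] pCons.prems obtain K
    where K: "K \<ge> 0" "\<And>u. \<bar>poly q u\<bar> \<le> K * exp (c / 2 * u\<^sup>2)" by auto
  have u: "\<bar>u\<bar> \<le> (1 + 2 / c) * exp (c / 2 * u\<^sup>2)" for u :: real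
  proof -
    have "\<bar>u\<bar> \<le> 1 + u\<^sup>2"
      using sum_squares_bound[of "\<bar>u\<bar>" 1] abs_ge_zero[of u] by (simp only: power2_abs mult_1_right one_power2)
    moreover have "c / 2 * u\<^sup>2 \<le> exp (c / 2 * u\<^sup>2)"
      using exp_ge_add_one_self[of "c / 2 * u\<^sup>2"] by linarith
    then have "u\<^sup>2 \<le> 2 / c * exp (c / 2 * u\<^sup>2)"
      using pCons.prems by (simp add: field_simps)
    moreover have "1 \<le> exp (c / 2 * u\<^sup>2)" using pCons.prems by simp
    ultimately have "\<bar>u\<bar> \<le> exp (c / 2 * u\<^sup>2) + 2 / c * exp (c / 2 * u\<^sup>2)" by linarith
    then show ?thesis by (simp only: distrib_right mult_1_left)
  qed
  have "\<bar>poly (pCons a q) u\<bar> \<le> (\<bar>a\<bar> + (1 + 2 / c) * K) * exp (c * u\<^sup>2)" for u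
  proof -
    have "\<bar>u * poly q u\<bar> \<le> ((1 + 2 / c) * exp (c / 2 * u\<^sup>2)) * (K * exp (c / 2 * u\<^sup>2))"
      unfolding abs_mult using u K pCons.prems by (intro mult_mono) auto
    also have "\<dots> = (1 + 2 / c) * K * exp (c * u\<^sup>2)"
      by (simp add: mult_ac flip: exp_add)
    finally have "\<bar>u * poly q u\<bar> \<le> (1 + 2 / c) * K * exp (c * u\<^sup>2)" .
    moreover have "\<bar>a\<bar> * 1 \<le> \<bar>a\<bar> * exp (c * u\<^sup>2)"
      using pCons.prems by (intro mult_left_mono) auto
    ultimately show ?thesis by (simp add: algebra_simps)
  qed
  then show ?case using K pCons.prems by (intro exI[of _ "\<bar>a\<bar> + (1 + 2 / c) * K"]) auto
qed

lemma integrable_exp_sq: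
  fixes c x :: real
  assumes "0 < c"
  shows "integrable lborel (\<lambda>s. exp (- (c * (s - x)\<^sup>2)))"
proof -
  define \<sigma> where "\<sigma> = sqrt (1 / (2 * c))"
  have \<sigma>: "\<sigma> > 0" "\<sigma>\<^sup>2 = 1 / (2 * c)" using assms by (auto simp: \<sigma>_def)
  have "integrable lborel (\<lambda>s. sqrt (2 * pi * \<sigma>\<^sup>2) * normal_density x \<sigma> s)"
    using \<sigma> by (intro integrable_mult_right) simp
  moreover have "sqrt (2 * pi * \<sigma>\<^sup>2) * normal_density x \<sigma> s = exp (- (c * (s - x)\<^sup>2))" for s
    using assms \<sigma> by (simp add: normal_density_def field_simps)
  ultimately show ?thesis by simp
qed

lemma square_integrable_exp_sq:
  fixes c x :: real
  assumes "0 < c"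
  shows "square_integrable (\<lambda>s. exp (- (c * (s - x)\<^sup>2)))"
proof -
  have "(exp (- (c * (s - x)\<^sup>2)))\<^sup>2 = exp (- (2 * c * (s - x)\<^sup>2))" for s
    by (simp add: power2_eq_square flip: exp_add)
  then show ?thesis
    using integrable_exp_sq[of "2 * c" x] assms by (simp add: square_integrable_def)
qed

lemma square_integrable_bound:
  assumes "square_integrable g" "f \<in> borel_measurable lborel" "\<And>s. \<bar>f s\<bar> \<le> g s"
  shows "square_integrable f"
proof -
  have "(f s)\<^sup>2 \<le> (g s)\<^sup>2" for s
    using power_mono[OF assms(3)[of s], of 2] by simp
  then have "AE s in lborel. norm ((f s)\<^sup>2) \<le> norm ((g s)\<^sup>2)" by simp
  then have "integrable lborel (\<lambda>s. (f s)\<^sup>2)"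
    by (rule Bochner_Integration.integrable_bound[rotated 2])
       (use assms in \<open>auto simp: square_integrable_def\<close>)
  with assms(2) show ?thesis by (simp add: square_integrable_def)
qed

lemma norm_abs_L2:
  assumes "square_integrable f"
  shows "norm (abs_L2 f) = sqrt (LINT s|lborel. (f s)\<^sup>2)"
  using assms by (simp add: norm_eq_sqrt_inner inner_abs_L2 power2_eq_square)

lemma norm_abs_L2_mono:
  assumes "square_integrable g" "f \<in> borel_measurable lborel" "\<And>s. \<bar>f s\<bar> \<le> g s"
  shows "norm (abs_L2 f) \<le> norm (abs_L2 g)"
proof -
  have "square_integrable f" using square_integrable_bound assms by blast
  moreover have "(f s)\<^sup>2 \<le> (g s)\<^sup>2" for s
    using power_mono[OF assms(3)[of s], of 2] by simp
  ultimately show ?thesis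
    using assms(1) by (auto simp: norm_abs_L2 square_integrable_def intro!: integral_mono)
qed

lemma abs_L2_add:
  assumes "square_integrable f" "square_integrable g"
  shows "abs_L2 f + abs_L2 g = abs_L2 (\<lambda>s. f s + g s)"
  using assms by (simp add: plus_L2.abs_eq L2_rel_def)

lemma abs_L2_scaleR:
  assumes "square_integrable f"
  shows "c *\<^sub>R abs_L2 f = abs_L2 (\<lambda>s. c * f s)"
  using assms by (simp add: scaleR_L2.abs_eq L2_rel_def)

lemma abs_L2_diff:
  assumes "square_integrable f" "square_integrable g"
  shows "abs_L2 f - abs_L2 g = abs_L2 (\<lambda>s. f s - g s)"
proof -
  have "abs_L2 f - abs_L2 g = abs_L2 f + (-1) *\<^sub>R abs_L2 g" by simp
  also have "\<dots> = abs_L2 (\<lambda>s. f s + - 1 * g s)"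
    using assms by (simp only: abs_L2_scaleR abs_L2_add square_integrable_scale)
  finally show ?thesis by simp
qed

definition poly_gauss :: "real poly \<Rightarrow> real \<Rightarrow> real \<Rightarrow> real" where
  "poly_gauss q x s = poly q (s - x) * exp (- (s - x)\<^sup>2)"

text \<open>The operator 2u - d/du on polynomials in u = s - x, that is, d/dx on multiples of exp
  (-u^2). Its iterates on 1 are the physicists' Hermite polynomials.\<close>

definition gauss_deriv :: "real poly \<Rightarrow> real poly" where
  "gauss_deriv q = pCons 0 (smult 2 q) - pderiv q"

lemma measurable_poly [measurable (raw)]:
  fixes q :: "real poly"
  assumes "f \<in> borel_measurable N"
  shows "(\<lambda>s. poly q (f s)) \<in> borel_measurable N"
proof -
  have "poly q \<in> borel_measurable borel"
    by (intro borel_measurable_continuous_onI continuous_intros)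
  from measurable_compose[OF assms this] show ?thesis .
qed

lemma measurable_poly_gauss [measurable]: "poly_gauss q x \<in> borel_measurable lborel"
  unfolding poly_gauss_def[abs_def] by measurable

lemma poly_gauss_bound: "\<exists>K\<ge>0. \<forall>x s. \<bar>poly_gauss q x s\<bar> \<le> K * exp (- (1 / 2 * (s - x)\<^sup>2))"
proof -
  from poly_le_exp_sq[of "1 / 2" q] obtain K
    where K: "K \<ge> 0" "\<And>u. \<bar>poly q u\<bar> \<le> K * exp (1 / 2 * u\<^sup>2)" by auto
  have "\<bar>poly_gauss q x s\<bar> \<le> K * exp (- (1 / 2 * (s - x)\<^sup>2))" for x s
  proof -
    have "\<bar>poly_gauss q x s\<bar> \<le> K * exp (1 / 2 * (s - x)\<^sup>2) * exp (- (s - x)\<^sup>2)"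
      unfolding poly_gauss_def abs_mult abs_exp_cancel using K(2) by (intro mult_right_mono) auto
    then show ?thesis by (simp add: mult.assoc flip: exp_add)
  qed
  with K(1) show ?thesis by blast
qed

lemma square_integrable_poly_gauss [simp]: "square_integrable (poly_gauss q x)"
proof -
  obtain K where K: "K \<ge> 0" "\<And>s. \<bar>poly_gauss q x s\<bar> \<le> K * exp (- (1 / 2 * (s - x)\<^sup>2))"
    using poly_gauss_bound[of q] by blast
  show ?thesis
    by (rule square_integrable_bound[OF square_integrable_scale[OF square_integrable_exp_sq] _ K(2)])
      simp_all
qed

lemma DERIV_poly_gauss:
  "((\<lambda>x. poly_gauss q x s) has_real_derivative poly_gauss (gauss_deriv q) x s) (at x)"
  unfolding poly_gauss_def gauss_deriv_def
  by (auto intro!: derivative_eq_intros poly_DERIV[THEN DERIV_chain2] simp: algebra_simps)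

text \<open>Taylor's formula in the center, with remainder at \<open>x + t\<close>. The rate drops
  from 1/2 to 1/4 to absorb the unknown shift \<open>t\<close>, so that the bound is
  \<open>h^2\<close> times a fixed square integrable function of \<open>s\<close>.\<close>

lemma poly_gauss_taylor_bound:
  "\<exists>K\<ge>0. \<forall>s x h. \<bar>h\<bar> \<le> 1 \<longrightarrow>
     \<bar>poly_gauss q (x + h) s - poly_gauss q x s - h * poly_gauss (gauss_deriv q) x s\<bar>
       \<le> K * h\<^sup>2 * exp (- (1 / 4 * (s - x)\<^sup>2))"
proof -
  let ?d = "\<lambda>m t s x. poly_gauss ((gauss_deriv ^^ m) q) (x + t) s"
  obtain K where K: "K \<ge> 0"
      "\<And>x s. \<bar>poly_gauss (gauss_deriv (gauss_deriv q)) x s\<bar> \<le> K * exp (- (1 / 2 * (s - x)\<^sup>2))"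
    using poly_gauss_bound by meson
  have "\<bar>poly_gauss q (x + h) s - poly_gauss q x s - h * poly_gauss (gauss_deriv q) x s\<bar>
       \<le> K * exp (1 / 2) / 2 * h\<^sup>2 * exp (- (1 / 4 * (s - x)\<^sup>2))" if h: "\<bar>h\<bar> \<le> 1" for s x h
  proof -
    have "\<forall>m t. ((\<lambda>t. ?d m t s x) has_real_derivative ?d (Suc m) t s x) (at t)"
    proof (intro allI)
      fix m t
      have "((\<lambda>t. x + t) has_real_derivative 1) (at t)" by (auto intro!: derivative_eq_intros)
      from DERIV_chain2[OF DERIV_poly_gauss this]
      show "((\<lambda>t. ?d m t s x) has_real_derivative ?d (Suc m) t s x) (at t)" by simp
    qed
    from Maclaurin_all_le[of "\<lambda>m t. ?d m t s x" "\<lambda>t. poly_gauss q (x + t) s", OF _ this, of h 2]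
    obtain t where t: "\<bar>t\<bar> \<le> \<bar>h\<bar>" and eq: "poly_gauss q (x + h) s =
        poly_gauss q x s + poly_gauss (gauss_deriv q) x s * h
          + poly_gauss (gauss_deriv (gauss_deriv q)) (x + t) s / 2 * h\<^sup>2"
      by (auto simp: numeral_2_eq_2)
    have "\<bar>t\<bar> \<le> 1" using t h by simp
    then have "t\<^sup>2 \<le> 1" by (simp add: abs_square_le_1)
    \<comment> \<open>With u = s - x: (u - t)^2 / 2 = u^2 / 4 + (u - 2t)^2 / 4 - t^2 / 2.\<close>
    moreover have "0 \<le> ((s - x) - 2 * t)\<^sup>2" by simp
    ultimately have "- (1 / 2 * (s - (x + t))\<^sup>2) \<le> 1 / 2 - 1 / 4 * (s - x)\<^sup>2"
      by (simp add: power2_eq_square field_simps)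
    then have "K * exp (- (1 / 2 * (s - (x + t))\<^sup>2)) \<le> K * exp (1 / 2 - 1 / 4 * (s - x)\<^sup>2)"
      using K(1) by (intro mult_left_mono) auto
    with K(2)[of "x + t" s]
    have "\<bar>poly_gauss (gauss_deriv (gauss_deriv q)) (x + t) s\<bar> \<le> K * exp (1 / 2 - 1 / 4 * (s - x)\<^sup>2)"
      by linarith
    then have "\<bar>poly_gauss (gauss_deriv (gauss_deriv q)) (x + t) s\<bar> / 2 * h\<^sup>2
        \<le> K * exp (1 / 2 - 1 / 4 * (s - x)\<^sup>2) / 2 * h\<^sup>2"
      by (intro mult_right_mono divide_right_mono) auto
    also have "\<dots> = K * exp (1 / 2) / 2 * h\<^sup>2 * exp (- (1 / 4 * (s - x)\<^sup>2))"
      proof -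
      have "exp (1 / 2 - 1 / 4 * (s - x)\<^sup>2) = exp (1 / 2) * exp (- (1 / 4 * (s - x)\<^sup>2))"
        by (simp flip: exp_add)
      then show ?thesis by (simp only: mult_ac times_divide_eq_left times_divide_eq_right)
    qed
    finally show ?thesis by (simp add: eq abs_mult)
  qed
  with K(1) show ?thesis by (intro exI[of _ "K * exp (1 / 2) / 2"]) auto
qed

section \<open>The kernel as a smooth curve in \<open>L2\<close>\<close>

definition PG :: "real poly \<Rightarrow> real \<Rightarrow> L2" where
  "PG q x = abs_L2 (poly_gauss q x)"

text \<open>Squaring and integrating the pointwise Taylor bound makes the remainder O(h^2) in
  norm.\<close>

lemma PG_has_vector_derivative:
  "(PG q has_vector_derivative PG (gauss_deriv q) x) (at x)"
proof -
  obtain K where K: "K \<ge> 0"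
    "\<And>s h. \<bar>h\<bar> \<le> 1 \<Longrightarrow>
     \<bar>poly_gauss q (x + h) s - poly_gauss q x s - h * poly_gauss (gauss_deriv q) x s\<bar>
       \<le> K * h\<^sup>2 * exp (- (1 / 4 * (s - x)\<^sup>2))"
    using poly_gauss_taylor_bound[of q] by blast
  define E where "E = abs_L2 (\<lambda>s. exp (- (1 / 4 * (s - x)\<^sup>2)))"
  have E: "square_integrable (\<lambda>s. exp (- (1 / 4 * (s - x)\<^sup>2)))"
    by (rule square_integrable_exp_sq) simp
  have bound: "norm (PG q (x + h) - PG q x - h *\<^sub>R PG (gauss_deriv q) x) \<le> K * h\<^sup>2 * norm E"
    if h: "\<bar>h\<bar> \<le> 1" for h
  proof -
    have sq: "square_integrable (\<lambda>s. f s - g s)" if "square_integrable f" "square_integrable g" for f g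
      using square_integrable_add[OF that(1) square_integrable_scale[OF that(2), of "-1"]] by simp
    have "norm (PG q (x + h) - PG q x - h *\<^sub>R PG (gauss_deriv q) x)
      = norm (abs_L2 (\<lambda>s. poly_gauss q (x + h) s - poly_gauss q x s - h * poly_gauss (gauss_deriv q) x s))"
      unfolding PG_def by (simp add: abs_L2_diff abs_L2_scaleR sq square_integrable_scale)
    also have "\<dots> \<le> norm (abs_L2 (\<lambda>s. K * h\<^sup>2 * exp (- (1 / 4 * (s - x)\<^sup>2))))"
      by (rule norm_abs_L2_mono[OF square_integrable_scale[OF E] _ K(2)[OF h]]) simp
    also have "\<dots> = norm ((K * h\<^sup>2) *\<^sub>R E)"
      using abs_L2_scaleR[OF E] by (simp add: E_def)
    finally show ?thesis using K(1) by simp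
  qed
  show ?thesis
    unfolding has_vector_derivative_def has_derivative_at_alt
  proof (intro conjI allI impI)
    show "bounded_linear (\<lambda>h. h *\<^sub>R PG (gauss_deriv q) x)" by (rule bounded_linear_scaleR_left)
    fix e :: real assume e: "0 < e"
    define C where "C = K * norm E + 1"
    have C: "C > 0" using K(1) by (simp add: C_def add_nonneg_pos)
    show "\<exists>d>0. \<forall>y. norm (y - x) < d \<longrightarrow>
      norm (PG q y - PG q x - (y - x) *\<^sub>R PG (gauss_deriv q) x) \<le> e * norm (y - x)"
    proof (intro exI[of _ "min 1 (e / C)"] conjI allI impI)
      show "0 < min 1 (e / C)" using e C by simp
      fix y assume y: "norm (y - x) < min 1 (e / C)"
      have "norm (PG q y - PG q x - (y - x) *\<^sub>R PG (gauss_deriv q) x) \<le> K * (y - x)\<^sup>2 * norm E"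
        using bound[of "y - x"] y by simp
      also have "\<dots> = K * norm E * \<bar>y - x\<bar> * \<bar>y - x\<bar>"
        by (simp add: power2_eq_square)
      also have "\<dots> \<le> C * \<bar>y - x\<bar> * \<bar>y - x\<bar>"
        by (intro mult_right_mono) (auto simp: C_def)
      also have "\<dots> \<le> e * \<bar>y - x\<bar>"
      proof (rule mult_right_mono)
        show "C * \<bar>y - x\<bar> \<le> e"
          using y C pos_less_divide_eq[OF C, of "\<bar>y - x\<bar>" e] by (simp add: mult.commute)
      qed simp
      finally show "norm (PG q y - PG q x - (y - x) *\<^sub>R PG (gauss_deriv q) x) \<le> e * norm (y - x)"
        by simp
    qed
  qed
qed

text \<open>Translation invariance of Lebesgue measure. This yields the uniform bounds on
  derivatives required by \<open>K_k\<close>.\<close>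

lemma norm_PG: "norm (PG q x) = norm (PG q 0)"
proof -
  have "(LINT s|lborel. (poly_gauss q 0 s)\<^sup>2) = (LINT s|lborel. (poly_gauss q x s)\<^sup>2)"
    using lborel_integral_real_affine[of 1 "\<lambda>s. (poly_gauss q 0 s)\<^sup>2" "- x"]
    by (simp add: poly_gauss_def algebra_simps)
  then show ?thesis by (simp add: PG_def norm_abs_L2)
qed

lemma framework_gaussian: "framework gaussian x = PG 1 x"
  proof -
  have "gaussian x = poly_gauss 1 x"
    by (simp add: poly_gauss_def gaussian_def fun_eq_iff power2_commute)
  then show ?thesis by (simp add: framework_def PG_def)
qed

lemma iter_deriv_framework:
  "iter_deriv k (framework gaussian) = PG ((gauss_deriv ^^ k) 1)"
proof (induction k)
  case 0
  then show ?case by (simp add: iter_deriv_def framework_gaussian fun_eq_iff)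
next
  case (Suc k)
  have "iter_deriv (Suc k) (framework gaussian)
      = (\<lambda>x. vector_derivative (iter_deriv k (framework gaussian)) (at x))"
    by (simp add: iter_deriv_def)
  then show ?case
    unfolding Suc using vector_derivative_at[OF PG_has_vector_derivative] by (auto simp: fun_eq_iff)
qed

lemma DERIV_inner_PG:
  "((\<lambda>x. inner (PG q x) p) has_real_derivative inner (PG (gauss_deriv q) x) p) (at x)"
  using bounded_linear.has_vector_derivative[OF bounded_linear_inner_left PG_has_vector_derivative]
  by (simp add: has_real_derivative_iff_has_vector_derivative)

lemma deriv_iter_Phi_adj:
  "(deriv ^^ k) (Phi_adj (framework gaussian) p) = (\<lambda>x. inner (PG ((gauss_deriv ^^ k) 1) x) p)"
proof (induction k)
  case 0
  then show ?case by (simp add: Phi_adj_def framework_gaussian fun_eq_iff)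
next
  case (Suc k)
  have "(deriv ^^ Suc k) (Phi_adj (framework gaussian) p)
      = deriv (\<lambda>x. inner (PG ((gauss_deriv ^^ k) 1) x) p)"
    by (simp only: funpow.simps o_apply Suc.IH)
  also have "\<dots> = (\<lambda>x. inner (PG (gauss_deriv ((gauss_deriv ^^ k) 1)) x) p)"
    by (rule ext, rule DERIV_imp_deriv, rule DERIV_inner_PG)
  finally show ?case by (simp only: funpow.simps o_apply)
qed

section \<open>Decay at infinity and membership in \<open>K_k\<close>\<close>

lemma L2_cases:
  obtains f where "square_integrable f" "p = abs_L2 f"
proof (rule that)
  show "square_integrable (rep_L2 p)"
    using Quotient_rep_reflp[OF Quotient_L2, of p] by (simp add: L2_rel_def)
  show "p = abs_L2 (rep_L2 p)"
    by (rule Quotient_abs_rep[OF Quotient_L2, symmetric])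
qed

text \<open>The kernel is the square of \<open>?e x\<close>. Cauchy-Schwarz separates one factor,
  whose norm \<open>N\<close> does not depend on \<open>x\<close>, from \<open>?e x s * f s\<close>,
  whose norm tends to 0 by dominated convergence with majorant \<open>(f s)^2\<close>. The sign
  \<open>\<sigma>\<close> treats both ends of the line at once.\<close>

lemma inner_PG_tendsto_0:
  assumes "\<sigma> = 1 \<or> \<sigma> = - 1"
  shows "((\<lambda>x. inner (PG 1 (\<sigma> * x)) p) \<longlongrightarrow> 0) at_top"
proof (cases p rule: L2_cases)
  case (1 f)
  have f: "f \<in> borel_measurable borel" "integrable lborel (\<lambda>s. (f s)\<^sup>2)"
    using 1 by (auto simp: square_integrable_def)
  note [measurable] = f(1)
  let ?e = "\<lambda>x s :: real. exp (- (1 / 2 * (s - x)\<^sup>2))"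
  have e: "square_integrable (?e x)" for x by (rule square_integrable_exp_sq) simp
  define N where "N = norm (abs_L2 (?e 0))"
  have N: "norm (abs_L2 (?e x)) = N" for x
    using lborel_integral_real_affine[of 1 "\<lambda>s. (?e 0 s)\<^sup>2" "- x"]
    unfolding N_def norm_abs_L2[OF e] by (simp add: add.commute)
  have ef: "square_integrable (\<lambda>s. ?e x s * f s)" for x
    unfolding square_integrable_def
  proof (intro conjI Bochner_Integration.integrable_bound[OF f(2)])
    show "AE s in lborel. norm ((?e x s * f s)\<^sup>2) \<le> norm ((f s)\<^sup>2)"
      by (auto simp: power_mult_distrib power_le_one intro!: mult_left_le_one_le)
  qed measurable
  have bound: "\<bar>inner (PG 1 x) p\<bar> \<le> N * sqrt (LINT s|lborel. (?e x s * f s)\<^sup>2)" for x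
  proof -
    have "inner (PG 1 x) p = (LINT s|lborel. ?e x s * (?e x s * f s))"
      unfolding 1(2) PG_def
      by (subst inner_abs_L2[OF square_integrable_poly_gauss 1(1)])
         (simp add: poly_gauss_def mult.assoc[symmetric] flip: exp_add)
    also have "\<dots> = inner (abs_L2 (?e x)) (abs_L2 (\<lambda>s. ?e x s * f s))"
      by (rule inner_abs_L2[OF e ef, symmetric])
    finally show ?thesis
      using Cauchy_Schwarz_ineq2[of "abs_L2 (?e x)" "abs_L2 (\<lambda>s. ?e x s * f s)"]
      by (simp only: N norm_abs_L2[OF ef])
  qed
  have "((\<lambda>x. LINT s|lborel. (?e (\<sigma> * x) s * f s)\<^sup>2) \<longlongrightarrow> (LINT s|(lborel :: real measure). (0::real))) at_top"
  proof (rule integral_dominated_convergence_at_top[where M = lborel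
        and s = "\<lambda>x s. (?e (\<sigma> * x) s * f s)\<^sup>2" and f = "\<lambda>s. 0" and w = "\<lambda>s. (f s)\<^sup>2"])
    show "\<forall>\<^sub>F x in at_top. AE s in lborel. norm ((?e (\<sigma> * x) s * f s)\<^sup>2) \<le> (f s)\<^sup>2"
      by (auto simp: power_mult_distrib power_le_one intro!: mult_left_le_one_le always_eventually)
    show "AE s in lborel. ((\<lambda>x. (?e (\<sigma> * x) s * f s)\<^sup>2) \<longlongrightarrow> 0) at_top"
    proof (rule AE_I2)
      fix s :: real
      have "((\<lambda>x. ?e (1 * x) s) \<longlongrightarrow> 0) at_top" "((\<lambda>x. ?e (- 1 * x) s) \<longlongrightarrow> 0) at_top"
        by (real_asymp, real_asymp)
      then have "((\<lambda>x. ?e (\<sigma> * x) s) \<longlongrightarrow> 0) at_top" using assms by blast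
      then have "((\<lambda>x. (?e (\<sigma> * x) s * f s)\<^sup>2) \<longlongrightarrow> (0 * f s)\<^sup>2) at_top"
        by (intro tendsto_intros)
      then show "((\<lambda>x. (?e (\<sigma> * x) s * f s)\<^sup>2) \<longlongrightarrow> 0) at_top" by simp
    qed
  qed (use f in auto)
  then have "((\<lambda>x. N * sqrt (LINT s|lborel. (?e (\<sigma> * x) s * f s)\<^sup>2)) \<longlongrightarrow> N * sqrt 0) at_top"
    by (intro tendsto_intros) simp
  then have "((\<lambda>x. N * sqrt (LINT s|lborel. (?e (\<sigma> * x) s * f s)\<^sup>2)) \<longlongrightarrow> 0) at_top" by simp
  moreover have "\<forall>\<^sub>F x in at_top. norm (inner (PG 1 (\<sigma> * x)) p)
      \<le> N * sqrt (LINT s|lborel. (?e (\<sigma> * x) s * f s)\<^sup>2)"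
    using bound by (auto intro!: always_eventually)
  ultimately show ?thesis by (rule Lim_null_comparison[rotated])
qed

lemma framework_C_0: "(\<lambda>x. inner p (framework gaussian x)) \<in> C_0"
  unfolding C_0_def
proof (intro CollectI conjI allI impI)
  show "continuous_on UNIV (\<lambda>x. inner p (framework gaussian x))"
    unfolding framework_gaussian inner_commute[of p]
    using DERIV_isCont[OF DERIV_inner_PG] by (auto intro: continuous_at_imp_continuous_on)
  fix \<epsilon> :: real assume "0 < \<epsilon>"
  have "\<exists>B. \<forall>x\<ge>B. \<bar>inner (PG 1 (\<sigma> * x)) p\<bar> < \<epsilon>" if "\<sigma> = 1 \<or> \<sigma> = - 1" for \<sigma>
    using tendstoD[OF inner_PG_tendsto_0[OF that] \<open>0 < \<epsilon>\<close>, of p]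
    by (auto simp: eventually_at_top_linorder)
  from this[of 1] this[of "- 1"] obtain B C
    where B: "\<And>x. x \<ge> B \<Longrightarrow> \<bar>inner (PG 1 x) p\<bar> < \<epsilon>"
      and C: "\<And>x. x \<ge> C \<Longrightarrow> \<bar>inner (PG 1 (- x)) p\<bar> < \<epsilon>" by auto
  show "\<exists>K. compact K \<and> (\<forall>x\<in>-K. \<bar>inner p (framework gaussian x)\<bar> \<le> \<epsilon>)"
  proof (intro exI conjI ballI)
    fix x assume "x \<in> - {- C..B}"
    then consider "x \<ge> B" | "- x \<ge> C" by fastforce
    then show "\<bar>inner p (framework gaussian x)\<bar> \<le> \<epsilon>"
      using B[of x] C[of "- x"] by cases (auto simp: framework_gaussian inner_commute)
  qed simp
qed

lemma framework_K_k: "framework gaussian \<in> K_k n"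
proof -
  have "iter_deriv i (framework gaussian) differentiable at x" for i x
    unfolding iter_deriv_framework using PG_has_vector_derivative by (rule differentiableI_vector)
  moreover have "continuous_on UNIV (iter_deriv n (framework gaussian))"
    unfolding iter_deriv_framework
    by (intro continuous_at_imp_continuous_on ballI
        has_vector_derivative_continuous[OF PG_has_vector_derivative])
  moreover have "bdd_above (range (\<lambda>x. norm (iter_deriv i (framework gaussian) x)))" for i
    unfolding iter_deriv_framework
    by (rule bdd_aboveI2, rule eq_refl, rule norm_PG)
  ultimately show ?thesis
    using framework_C_0 by (auto simp: K_k_def C_k_def)
qed

subsection \<open>Minimal norm interpolation\<close>

text \<open>A Gram-Schmidt induction: the part \<open>w\<close> of the new vector orthogonal to the
  earlier ones is nonzero by independence, and adding a multiple of it corrects the new value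
  without disturbing the others.\<close>

lemma independent_family_interpolation:
  fixes v :: "'i \<Rightarrow> 'h::real_inner"
  assumes "finite I" and indep: "\<And>b. (\<Sum>i\<in>I. b i *\<^sub>R v i) = 0 \<Longrightarrow> \<forall>i\<in>I. b i = 0"
  shows "\<exists>b. \<forall>j\<in>I. inner (v j) (\<Sum>i\<in>I. b i *\<^sub>R v i) = c j"
  using assms
proof (induction I arbitrary: c rule: finite_induct)
  case empty
  then show ?case by simp
next
  case (insert k I)
  have upd: "(\<Sum>i\<in>I. (b(k := t)) i *\<^sub>R v i) = (\<Sum>i\<in>I. b i *\<^sub>R v i)" for b t
    using insert.hyps by (intro sum.cong) auto
  have "\<forall>i\<in>I. b i = 0" if "(\<Sum>i\<in>I. b i *\<^sub>R v i) = 0" for b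
  proof -
    have "\<forall>i\<in>insert k I. (b(k := 0)) i = 0"
      by (rule insert.prems) (use insert.hyps that upd[of b 0] in \<open>simp add: sum.insert\<close>)
    then show ?thesis using insert.hyps by (auto simp: fun_upd_def split: if_splits)
  qed
  note IH = insert.IH[OF this]
  obtain b0 where b0: "\<forall>j\<in>I. inner (v j) (\<Sum>i\<in>I. b0 i *\<^sub>R v i) = c j" using IH by blast
  \<comment> \<open>The orthogonal projection \<open>q\<close> of \<open>v k\<close> onto the
    earlier span is itself an interpolant, for the data \<open>inner (v j) (v k)\<close>.\<close>
  obtain e where e: "\<forall>j\<in>I. inner (v j) (\<Sum>i\<in>I. e i *\<^sub>R v i) = inner (v j) (v k)"
    using IH[of "\<lambda>j. inner (v j) (v k)"] by blast
  define p where "p = (\<Sum>i\<in>I. b0 i *\<^sub>R v i)"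
  define q where "q = (\<Sum>i\<in>I. e i *\<^sub>R v i)"
  define w where "w = v k - q"
  have w: "inner (v j) w = 0" if "j \<in> I" for j
    using e that by (simp add: w_def q_def inner_diff_right)
  have "w \<noteq> 0"
  proof
    assume "w = 0"
    have "(\<Sum>i\<in>insert k I. ((\<lambda>i. - e i)(k := 1)) i *\<^sub>R v i) = w"
      using insert.hyps upd[of "\<lambda>i. - e i" 1]
      by (simp add: w_def q_def sum_negf)
    then have "((\<lambda>i. - e i)(k := 1)) k = 0" using insert.prems \<open>w = 0\<close> by blast
    then show False by simp
  qed
  have "inner q w = 0"
    unfolding q_def inner_sum_left using w by simp
  then have kw: "inner (v k) w = inner w w" by (simp add: w_def inner_diff_left)
  define t where "t = (c k - inner (v k) p) / inner w w"
  define b where "b = (\<lambda>i. b0 i - t * e i)(k := t)"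
  have "(\<Sum>i\<in>insert k I. b i *\<^sub>R v i) = p + t *\<^sub>R w"
    using insert.hyps upd[of "\<lambda>i. b0 i - t * e i" t]
    by (simp add: b_def p_def w_def q_def sum_subtractf scaleR_diff_left scaleR_diff_right
        scaleR_sum_right)
  moreover have "inner (v j) (p + t *\<^sub>R w) = c j" if "j \<in> insert k I" for j
    using that b0 w kw \<open>w \<noteq> 0\<close> by (auto simp: inner_add_right p_def t_def)
  ultimately show ?case by (intro exI[of _ b]) auto
qed

text \<open>An interpolant in the span of the \<open>v i\<close> is orthogonal to its difference
  from any other interpolant. Pythagoras then gives minimality and also the uniqueness that the
  definite description in \<open>min_norm_elt\<close> requires.\<close>

lemma min_norm_elt_interpolation:
  fixes v :: "'i \<Rightarrow> 'h::real_inner"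
  assumes "p = (\<Sum>i\<in>I. b i *\<^sub>R v i)" and p: "\<And>j. j \<in> I \<Longrightarrow> inner (v j) p = c j"
  shows "min_norm_elt {q. \<forall>j\<in>I. inner (v j) q = c j} = p"
proof -
  have pyth: "(norm q)\<^sup>2 = (norm p)\<^sup>2 + (norm (q - p))\<^sup>2" if "\<forall>j\<in>I. inner (v j) q = c j" for q
  proof -
    have "inner p (q - p) = (\<Sum>i\<in>I. b i * inner (v i) (q - p))"
      by (subst assms(1)) (simp add: inner_sum_left)
    also have "\<dots> = 0"
      using that p by (intro sum.neutral) (auto simp: inner_diff_right)
    finally have "inner p (q - p) = 0" .
    then show ?thesis
      by (simp add: power2_norm_eq_inner inner_diff_left inner_diff_right inner_commute)
  qed
  show ?thesis
    unfolding min_norm_elt_def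
  proof (rule the_equality)
    have "norm p \<le> norm q" if "\<forall>j\<in>I. inner (v j) q = c j" for q
      by (rule power2_le_imp_le) (use pyth[OF that] in auto)
    then show "is_arg_min norm (\<lambda>q. q \<in> {q. \<forall>j\<in>I. inner (v j) q = c j}) p"
      using p by (auto simp: is_arg_min_def not_less)
    fix q assume "is_arg_min norm (\<lambda>q. q \<in> {q. \<forall>j\<in>I. inner (v j) q = c j}) q"
    then have q: "\<forall>j\<in>I. inner (v j) q = c j" "norm q \<le> norm p"
      using p by (auto simp: is_arg_min_def not_less)
    from q(2) have "(norm q)\<^sup>2 \<le> (norm p)\<^sup>2" by (intro power_mono) auto
    with pyth[OF q(1)] show "q = p" by simp
  qed
qed

subsection \<open>Counting zeros with multiplicity\<close>

text \<open>Points are added in increasing order, each giving a zero between the old maximum and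
  itself. The bound by \<open>Max A\<close> shows that this zero is new.\<close>

lemma rolle_finite:
  fixes f f' :: "real \<Rightarrow> real"
  assumes "finite A" "A \<noteq> {}" "\<And>z. z \<in> A \<Longrightarrow> f z = 0"
    and f': "\<And>x. (f has_real_derivative f' x) (at x)"
  shows "\<exists>B. finite B \<and> A \<inter> B = {} \<and> Suc (card B) = card A \<and> (\<forall>z\<in>B. f' z = 0)
    \<and> (\<forall>z\<in>B. z < Max A)"
  using assms(1-3)
proof (induction A rule: finite_linorder_max_induct)
  case empty
  then show ?case by simp
next
  case (insert b A)
  show ?case
  proof (cases "A = {}")
    case True
    then show ?thesis by (intro exI[of _ "{}"]) simp
  next
    case False
    with insert obtain B where B: "finite B" "A \<inter> B = {}" "Suc (card B) = card A"
        "\<forall>z\<in>B. f' z = 0" "\<forall>z\<in>B. z < Max A" by auto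
    have m: "Max A < b" "f (Max A) = 0" using insert False by auto
    obtain z where z: "Max A < z" "z < b" "(f has_real_derivative 0) (at z)"
      using Rolle[of "Max A" b f] m insert.prems f'
      by (metis DERIV_isCont continuous_at_imp_continuous_on insertI1 real_differentiable_def)
    have "f' z = 0" using DERIV_unique[OF f' z(3)] .
    have A: "a \<le> Max A" if "a \<in> A" for a using insert.hyps that by simp
    have "z \<notin> A" "z \<notin> B" "b \<notin> B" "b \<notin> A" using A B(5) z m by fastforce+
    then have "insert b A \<inter> insert z B = {}" "Suc (card (insert z B)) = card (insert b A)"
      using B(1-3) z insert.hyps(1) by auto
    moreover have "\<forall>x\<in>insert z B. x < b" using B(5) z m by fastforce
    moreover have "Max (insert b A) = b"
      using insert.hyps by (intro Max_eqI) (auto intro: less_imp_le)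
    ultimately show ?thesis
      using B(1,4) \<open>f' z = 0\<close> by (intro exI[of _ "insert z B"]) simp
  qed
qed

text \<open>The integrating factor exp (y^2 / 2 - a y) turns f' + (y - a) f = h into a plain
  derivative and changes no zeros.\<close>

lemma rolle_weighted:
  fixes f h :: "real \<Rightarrow> real" and a :: real
  assumes "finite A" "A \<noteq> {}" "\<And>z. z \<in> A \<Longrightarrow> f z = 0"
    and f: "\<And>y. (f has_real_derivative h y - (y - a) * f y) (at y)"
  shows "\<exists>B. finite B \<and> A \<inter> B = {} \<and> Suc (card B) = card A \<and> (\<forall>z\<in>B. h z = 0)"
proof -
  have "((\<lambda>y. exp (y\<^sup>2 / 2 - a * y) * f y) has_real_derivative exp (y\<^sup>2 / 2 - a * y) * h y) (at y)" for y
    by (auto intro!: derivative_eq_intros f simp: algebra_simps)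
  from rolle_finite[OF assms(1,2) _ this] assms(3) show ?thesis by fastforce
qed

text \<open>The set \<open>A\<close> and the function \<open>m\<close> record zeros with multiplicity: a zero of order \<open>m\<close> of
  \<open>g k\<close> is one at which \<open>g k, \<dots>, g (k + m - 1)\<close> vanish. Passing from \<open>g k\<close> to \<open>g (k + 1)\<close> lowers each
  order by one, and Rolle's theorem for \<open>exp (y\<^sup>2 / 2 - a k y) g k y\<close> supplies \<open>card A - 1\<close> new zeros.\<close>

lemma zero_of_last:
  fixes g :: "nat \<Rightarrow> real \<Rightarrow> real" and a :: "nat \<Rightarrow> real"
  assumes g: "\<And>k y. k < n \<Longrightarrow> (g k has_real_derivative g (Suc k) y - (y - a k) * g k y) (at y)"
    and "finite A" "\<And>z. z \<in> A \<Longrightarrow> 0 < m z" "\<And>z i. z \<in> A \<Longrightarrow> i < m z \<Longrightarrow> g i z = 0"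
    and "n < (\<Sum>z\<in>A. m z)"
  shows "\<exists>z. g n z = 0"
  using assms
proof (induction n arbitrary: g a A m)
  case 0
  then have "A \<noteq> {}" by auto
  with 0 show ?case by fastforce
next
  case (Suc n)
  have "A \<noteq> {}" using Suc.prems(5) by auto
  have "g 0 z = 0" if "z \<in> A" for z using Suc.prems(3,4) that by blast
  from rolle_weighted[OF Suc.prems(2) \<open>A \<noteq> {}\<close> this Suc.prems(1)[of 0]]
  obtain B where B: "finite B" "A \<inter> B = {}" "Suc (card B) = card A" "\<forall>z\<in>B. g 1 z = 0" by auto
  \<comment> \<open>Simple zeros are dropped, because multiplicities must stay positive; the points
    of \<open>B\<close> lie outside \<open>A\<close> and enter with multiplicity 1.\<close>
  define A' where "A' = {z \<in> A. m z \<noteq> 1} \<union> B"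
  define m' where "m' = (\<lambda>z. if z \<in> A then m z - 1 else 1)"
  have "\<exists>z. g (Suc n) z = 0"
  proof (rule Suc.IH[of "\<lambda>k. g (Suc k)" "\<lambda>k. a (Suc k)" A' m'])
    show "(g (Suc k) has_real_derivative g (Suc (Suc k)) y - (y - a (Suc k)) * g (Suc k) y) (at y)"
      if "k < n" for k y using Suc.prems(1)[of "Suc k"] that by simp
    show "finite A'" using Suc.prems(2) B by (simp add: A'_def)
    show "0 < m' z" if "z \<in> A'" for z
      using that Suc.prems(3)[of z] B(2) by (auto simp: A'_def m'_def)
    show "g (Suc i) z = 0" if "z \<in> A'" "i < m' z" for z i
      using that Suc.prems(4)[of z "Suc i"] B(2,4) by (auto simp: A'_def m'_def split: if_splits)
    \<comment> \<open>The total loses \<open>card A\<close> and regains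
      \<open>card B = card A - 1\<close>, so it falls by exactly one, as does
      \<open>n\<close>.\<close>
    have "(\<Sum>z\<in>A. m z) = (\<Sum>z\<in>A. m' z + 1)"
      using Suc.prems(3) by (intro sum.cong) (auto simp: m'_def Suc_leI)
    also have "\<dots> = (\<Sum>z\<in>A. m' z) + Suc (card B)" by (simp only: sum.distrib B(3) flip: card_eq_sum)
    also have "(\<Sum>z\<in>A. m' z) = (\<Sum>z\<in>{z \<in> A. m z \<noteq> 1}. m' z)"
      using Suc.prems(2) by (intro sum.mono_neutral_right) (auto simp: m'_def)
    also have "card B = (\<Sum>z\<in>B. m' z)"
      using B(2) by (subst card_eq_sum, intro sum.cong) (auto simp: m'_def)
    finally have "(\<Sum>z\<in>A. m z) = Suc ((\<Sum>z\<in>{z \<in> A. m z \<noteq> 1}. m' z) + (\<Sum>z\<in>B. m' z))" by simp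
    also have "(\<Sum>z\<in>{z \<in> A. m z \<noteq> 1}. m' z) + (\<Sum>z\<in>B. m' z) = (\<Sum>z\<in>A'. m' z)"
      unfolding A'_def using Suc.prems(2) B by (intro sum.union_disjoint[symmetric]) auto
    finally show "n < (\<Sum>z\<in>A'. m' z)" using Suc.prems(5) by simp
  qed
  then show ?case .
qed

text \<open>Since \<open>g k\<close> is \<open>d k\<close> plus lower derivatives with polynomial
  coefficients, a zero of order m of \<open>d 0\<close> in the usual sense also makes the first m
  functions \<open>g i\<close> vanish.\<close>

lemma derivs_of_recursion:
  fixes g d :: "nat \<Rightarrow> real \<Rightarrow> real" and a :: "nat \<Rightarrow> real"
  assumes g: "\<And>k y. k < n \<Longrightarrow> (g k has_real_derivative g (Suc k) y - (y - a k) * g k y) (at y)"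
    and d: "\<And>k y. (d k has_real_derivative d (Suc k) y) (at y)"
    and "g 0 = d 0" and "k \<le> n"
  shows "\<exists>c :: nat \<Rightarrow> real poly. \<forall>y. g k y = d k y + (\<Sum>i<k. poly (c i) y * d i y)"
  using \<open>k \<le> n\<close>
proof (induction k)
  case 0
  then show ?case using assms(3) by simp
next
  case (Suc k)
  then obtain c :: "nat \<Rightarrow> real poly" where c: "\<And>y. g k y = d k y + (\<Sum>i<k. poly (c i) y * d i y)"
    by auto
  have gk: "g k = (\<lambda>y. d k y + (\<Sum>i<k. poly (c i) y * d i y))" using c by auto
  define p where "p = [:- a k, 1:]"
  \<comment> \<open>From differentiating c_i d_i and multiplying by \<open>p\<close>: the case i = k
    comes from the leading \<open>d k\<close>, the last summand from the shifted terms c_i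
    d_(i+1).\<close>
  define e where "e = (\<lambda>i. (if i < k then pderiv (c i) + p * c i else p) +
      (if i = 0 then 0 else c (i - 1)))"
  have "g (Suc k) y = d (Suc k) y + (\<Sum>i<Suc k. poly (e i) y * d i y)" for y
  proof -
    have "(g k has_real_derivative d (Suc k) y
        + (\<Sum>i<k. poly (pderiv (c i)) y * d i y + d (Suc i) y * poly (c i) y)) (at y)"
      unfolding gk by (intro DERIV_add DERIV_sum DERIV_mult d poly_DERIV)
    from DERIV_unique[OF g this] have "g (Suc k) y - (y - a k) * g k y = d (Suc k) y
        + (\<Sum>i<k. poly (pderiv (c i)) y * d i y + d (Suc i) y * poly (c i) y)"
      using Suc.prems by simp
    then have "g (Suc k) y = d (Suc k) y
        + (\<Sum>i<k. poly (pderiv (c i)) y * d i y + d (Suc i) y * poly (c i) y)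
        + poly p y * (d k y + (\<Sum>i<k. poly (c i) y * d i y))"
      by (simp add: p_def c algebra_simps)
    also have "\<dots> = d (Suc k) y + (\<Sum>i<k. poly (pderiv (c i) + p * c i) y * d i y)
        + poly p y * d k y + (\<Sum>i<k. poly (c i) y * d (Suc i) y)"
      by (simp add: sum.distrib sum_distrib_left algebra_simps)
    also have "\<dots> = d (Suc k) y + (\<Sum>i<Suc k. poly (if i < k then pderiv (c i) + p * c i else p) y * d i y)
        + (\<Sum>i<Suc k. poly (if i = 0 then 0 else c (i - 1)) y * d i y)"
      by (subst (2) sum.lessThan_Suc_shift) simp
    also have "\<dots> = d (Suc k) y + (\<Sum>i<Suc k. poly (e i) y * d i y)"
      by (simp add: e_def sum.distrib distrib_right del: sum.lessThan_Suc)
    finally show ?thesis .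
  qed
  then show ?case by blast
qed

text \<open>In Taylor's formula only the remainder survives, and its factors
  \<open>d m (z + t)\<close> and \<open>(y - z) ^ m\<close> are positive near
  \<open>z\<close>.\<close>

lemma even_order_zero_pos:
  fixes d :: "nat \<Rightarrow> real \<Rightarrow> real"
  assumes d: "\<And>k y. (d k has_real_derivative d (Suc k) y) (at y)"
    and "even m" "0 < m" "\<And>k. k < m \<Longrightarrow> d k z = 0" "0 < d m z"
  shows "\<forall>\<^sub>F y in at z. 0 < d 0 y"
proof -
  have "isCont (d m) z" by (rule DERIV_isCont[OF d])
  then have "\<forall>\<^sub>F y in nhds z. 0 < d m y"
    using assms(5) by (simp add: continuous_at tendsto_at_iff_tendsto_nhds order_tendstoD(1))
  then obtain r where r: "r > 0" "\<And>y. dist y z < r \<Longrightarrow> 0 < d m y"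
    by (auto simp: eventually_nhds_metric)
  have "0 < d 0 y" if y: "y \<noteq> z" "dist y z < r" for y
  proof -
    have "((\<lambda>h. d k (z + h)) has_real_derivative d (Suc k) (z + h)) (at h)" for k h
    proof -
      have "((\<lambda>h. z + h) has_real_derivative 1) (at h)" by (auto intro!: derivative_eq_intros)
      from DERIV_chain2[OF d this] show ?thesis by simp
    qed
    then obtain t where t: "\<bar>t\<bar> \<le> \<bar>y - z\<bar>"
      and eq: "d 0 (z + (y - z)) = (\<Sum>k<m. d k (z + 0) / fact k * (y - z) ^ k)
          + d m (z + t) / fact m * (y - z) ^ m"
      using Maclaurin_all_le[of "\<lambda>k h. d k (z + h)" "\<lambda>h. d 0 (z + h)" "y - z" m] by blast
    have "(\<Sum>k<m. d k (z + 0) / fact k * (y - z) ^ k) = 0" using assms(4) by simp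
    moreover have "0 < d m (z + t)" using r(2)[of "z + t"] t y by (simp add: dist_real_def)
    moreover have "0 < (y - z) ^ m" using y \<open>even m\<close> by (simp add: zero_less_power_eq)
    ultimately show ?thesis using eq by simp
  qed
  then show ?thesis using r(1) by (auto simp: eventually_at)
qed

subsection \<open>Interpolation by polynomial multiples of Gaussians\<close>

text \<open>The supremum \<open>T\<close> of the points with negative value would be a zero. Of even
  order, it has one sign on both sides: a positive sign contradicts negative values arbitrarily
  close to \<open>T\<close> on the left, a negative sign contradicts that \<open>T\<close> is an
  upper bound.\<close>

lemma nonneg_of_even_zeros:
  fixes d :: "nat \<Rightarrow> real \<Rightarrow> real"
  assumes d: "\<And>k y. (d k has_real_derivative d (Suc k) y) (at y)"
    and zeros: "\<And>z. d 0 z = 0 \<Longrightarrow> \<exists>m>0. even m \<and> (\<forall>k<m. d k z = 0) \<and> d m z \<noteq> 0"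
    and top: "\<forall>\<^sub>F y in at_top. 0 < d 0 y"
  shows "0 \<le> d 0 y"
proof (rule ccontr)
  assume "\<not> 0 \<le> d 0 y"
  define S where "S = {y. d 0 y < 0}"
  have S: "S \<noteq> {}" "bdd_above S"
  proof -
    show "S \<noteq> {}" using \<open>\<not> 0 \<le> d 0 y\<close> by (auto simp: S_def not_le)
    from top obtain B where "\<And>y. y \<ge> B \<Longrightarrow> 0 < d 0 y" by (auto simp: eventually_at_top_linorder)
    then show "bdd_above S" unfolding S_def
      by (intro bdd_aboveI[of _ B]) (metis linorder_le_cases mem_Collect_eq order_less_asym)
  qed
  define T where "T = Sup S"
  have left: "\<exists>s\<in>S. T - r < s \<and> s \<le> T" if "r > 0" for r
    using less_cSup_iff[OF S, of "T - r"] cSup_upper[OF _ S(2)] that unfolding T_def by force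
  have right: "s \<notin> S" if "T < s" for s
    using cSup_upper[OF _ S(2)] that unfolding T_def by force
  have cont: "isCont (d 0) T" by (rule DERIV_isCont[OF d])
  have pos: False if "0 < d 0 T \<or> d 0 T = 0 \<and> (\<forall>\<^sub>F y in at T. 0 < d 0 y)"
  proof -
    have "\<forall>\<^sub>F y in at T. 0 < d 0 y"
      using that order_tendstoD(1)[OF cont[unfolded isCont_def]] by blast
    then obtain r where "r > 0" "\<And>y. y \<noteq> T \<Longrightarrow> dist y T < r \<Longrightarrow> 0 < d 0 y"
      by (auto simp: eventually_at)
    moreover obtain s where "s \<in> S" "T - r < s" "s \<le> T" using left \<open>r > 0\<close> by blast
    ultimately have "s = T" by (force simp: S_def dist_real_def)
    with \<open>s \<in> S\<close> that show False by (auto simp: S_def)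
  qed
  have neg: False if ev: "\<forall>\<^sub>F y in at T. d 0 y < 0"
  proof -
    obtain r where "r > 0" "\<And>y. y \<noteq> T \<Longrightarrow> dist y T < r \<Longrightarrow> d 0 y < 0"
      using ev by (auto simp: eventually_at)
    then have "d 0 (T + r / 2) < 0" by (auto simp: dist_real_def)
    with right[of "T + r / 2"] \<open>r > 0\<close> show False by (simp add: S_def)
  qed
  have "d 0 T = 0"
    using pos neg order_tendstoD(2)[OF cont[unfolded isCont_def], of 0]
    by (metis linorder_less_linear)
  from zeros[OF this] obtain m where m: "m > 0" "even m" "\<And>k. k < m \<Longrightarrow> d k T = 0" "d m T \<noteq> 0"
    by auto
  show False
  proof (cases "0 < d m T")
    case True
    from even_order_zero_pos[OF d m(2,1,3) this] pos \<open>d 0 T = 0\<close> show False by blast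
  next
    case False
    have "\<forall>\<^sub>F y in at T. 0 < - d 0 y"
      by (rule even_order_zero_pos[of "\<lambda>k y. - d k y" m])
         (use m False in \<open>auto intro!: derivative_eq_intros d\<close>)
    with neg show False by simp
  qed
qed

section \<open>The first-order operators acting on Gaussian terms\<close>

definition shift_deriv :: "real \<Rightarrow> real poly \<Rightarrow> real \<Rightarrow> real poly" where
  "shift_deriv z q a = pderiv q + smult (z - a) q"

text \<open>The operator g' + (y - a) g keeps the Gaussian centered at \<open>z\<close> and changes
  only its polynomial; for a = z it is mere differentiation of \<open>q\<close>.\<close>

lemma DERIV_poly_exp:
  "((\<lambda>y. poly q y * exp (- (y - z)\<^sup>2 / 2)) has_real_derivative
     poly (shift_deriv z q a) y * exp (- (y - z)\<^sup>2 / 2)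
       - (y - a) * (poly q y * exp (- (y - z)\<^sup>2 / 2))) (at y)"
proof -
  have "((\<lambda>y. exp (- (y - z)\<^sup>2 / 2)) has_real_derivative exp (- (y - z)\<^sup>2 / 2) * (z - y)) (at y)"
    by (auto intro!: derivative_eq_intros simp: field_simps)
  from DERIV_mult[OF poly_DERIV[of q] this] show ?thesis
    by (rule DERIV_cong) (simp add: shift_deriv_def algebra_simps)
qed

lemma shift_deriv_0: "foldl (shift_deriv z) 0 as = 0"
  by (induction as) (simp_all add: shift_deriv_def)

text \<open>Each occurrence of \<open>z\<close> differentiates the polynomial, and the other entries
  never raise its degree.\<close>

lemma foldl_shift_deriv_eq_0:
  assumes "degree q < length (filter ((=) z) as)"
  shows "foldl (shift_deriv z) q as = 0"
  using assms
proof (induction as arbitrary: q)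
  case (Cons a as)
  show ?case
  proof (cases "shift_deriv z q a = 0")
    case False
    have "degree (shift_deriv z q a) < length (filter ((=) z) as)"
    proof (cases "z = a")
      case True
      with False Cons.prems show ?thesis
        by (cases "degree q = 0") (auto simp: shift_deriv_def degree_pderiv pderiv_eq_0_iff)
    next
      case False
      have "degree (shift_deriv z q a) \<le> degree q"
        unfolding shift_deriv_def by (intro degree_add_le) (auto simp: degree_pderiv)
      with False Cons.prems show ?thesis by simp
    qed
    with Cons.IH show ?thesis by simp
  qed (simp add: shift_deriv_0)
qed simp

text \<open>For a distinct from z, the coefficient at the old degree is multiplied by the nonzero
  number z - a.\<close>

lemma foldl_shift_deriv_neq_0:
  assumes "z \<notin> set as" "q \<noteq> 0"
  shows "foldl (shift_deriv z) q as \<noteq> 0"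
  using assms
proof (induction as arbitrary: q)
  case (Cons a as)
  have "coeff (shift_deriv z q a) (degree q) = (z - a) * lead_coeff q"
    by (simp add: shift_deriv_def coeff_pderiv coeff_eq_0)
  then have "shift_deriv z q a \<noteq> 0" using Cons.prems by auto
  with Cons show ?case by simp
qed simp

text \<open>A list, because the operators are applied one after another by
  \<open>foldl\<close>.\<close>

definition node_list :: "('i \<Rightarrow> nat) \<Rightarrow> ('i \<Rightarrow> 'a) \<Rightarrow> 'i list \<Rightarrow> 'a list" where
  "node_list m x is = concat (map (\<lambda>i. replicate (m i) (x i)) is)"

lemma node_list_simps [simp]:
  "node_list m x [] = []"
  "node_list m x (i # is) = replicate (m i) (x i) @ node_list m x is"
  by (simp_all add: node_list_def)

lemma length_node_list: "length (node_list m x is) = sum_list (map m is)"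
  by (induction "is") simp_all

lemma set_node_list: "set (node_list m x is) \<subseteq> x ` set is"
  by (induction "is") auto

lemma filter_node_list: "i \<in> set is \<Longrightarrow> m i \<le> length (filter ((=) (x i)) (node_list m x is))"
  by (induction "is") (auto simp: trans_le_add2)

lemma prod_node_list:
  "prod_list (map f (node_list m x is)) = (\<Prod>i\<leftarrow>is. f (x i) ^ m i :: 'b::comm_monoid_mult)"
  by (induction "is") simp_all

lemma gaussian_combination_shift:
  fixes x :: "'i \<Rightarrow> real" and q :: "'i \<Rightarrow> real poly"
  assumes "\<And>y. (\<Sum>i\<in>I. poly (q i) y * exp (- (y - x i)\<^sup>2 / 2)) = 0"
  shows "(\<Sum>i\<in>I. poly (foldl (shift_deriv (x i)) (q i) as) y * exp (- (y - x i)\<^sup>2 / 2)) = 0"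
  using assms
proof (induction as arbitrary: q y)
  case (Cons a as)
  let ?E = "\<lambda>i y. exp (- (y - x i)\<^sup>2 / 2)"
  have "(\<Sum>i\<in>I. poly (shift_deriv (x i) (q i) a) y * ?E i y) = 0" for y
  proof -
    have "((\<lambda>y. \<Sum>i\<in>I. poly (q i) y * ?E i y) has_real_derivative
      (\<Sum>i\<in>I. poly (shift_deriv (x i) (q i) a) y * ?E i y - (y - a) * (poly (q i) y * ?E i y))) (at y)"
      by (intro DERIV_sum DERIV_poly_exp)
    then have "(\<Sum>i\<in>I. poly (shift_deriv (x i) (q i) a) y * ?E i y
        - (y - a) * (poly (q i) y * ?E i y)) = 0"
      using DERIV_unique[OF _ DERIV_const[of 0 "at y"]] Cons.prems by simp
    then show ?thesis
      using Cons.prems[of y] by (simp add: sum_subtractf flip: sum_distrib_left)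
  qed
  from Cons.IH[OF this] show ?case by simp
qed simp

text \<open>The operators at the other nodes annihilate every term but the one at
  \<open>x j\<close>, whose polynomial stays nonzero.\<close>

lemma gaussian_combination_independent:
  fixes x :: "'i \<Rightarrow> real" and q :: "'i \<Rightarrow> real poly"
  assumes "finite I" "inj_on x I"
    and z: "\<And>y. (\<Sum>i\<in>I. poly (q i) y * exp (- (y - x i)\<^sup>2 / 2)) = 0"
    and "j \<in> I"
  shows "q j = 0"
proof (rule ccontr)
  assume "q j \<noteq> 0"
  obtain "is" where "is": "set is = I - {j}" "distinct is"
    using finite_distinct_list \<open>finite I\<close> by (metis finite_Diff)
  \<comment> \<open>One repetition more than the degree, just enough for
    \<open>foldl_shift_deriv_eq_0\<close>.\<close>
  define as where "as = node_list (\<lambda>i. Suc (degree (q i))) x is"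
  have "x j \<notin> set as"
    using set_node_list[of "\<lambda>i. Suc (degree (q i))" x "is"] "is" \<open>inj_on x I\<close> \<open>j \<in> I\<close>
    by (auto simp: as_def inj_on_def)
  define r where "r = foldl (shift_deriv (x j)) (q j) as"
  have "r \<noteq> 0" unfolding r_def using \<open>x j \<notin> set as\<close> \<open>q j \<noteq> 0\<close> by (rule foldl_shift_deriv_neq_0)
  have "foldl (shift_deriv (x i)) (q i) as = 0" if "i \<in> I - {j}" for i
    using filter_node_list[of i "is" "\<lambda>i. Suc (degree (q i))" x] that "is"
    by (intro foldl_shift_deriv_eq_0) (simp add: as_def Suc_le_eq)
  then have "poly r y * exp (- (y - x j)\<^sup>2 / 2) = 0" for y
    using gaussian_combination_shift[OF z, where as = as and y = y] \<open>finite I\<close> \<open>j \<in> I\<close>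
    by (simp add: sum.remove[of I j] r_def)
  then have "\<forall>y. poly r y = 0" by simp
  then have "r = 0" by (simp only: poly_all_0_iff_0)
  with \<open>r \<noteq> 0\<close> show False by simp
qed

section \<open>The constant 1 as a Gaussian integral\<close>

lemma inner_PG_eq:
  "inner (PG p x) (PG q y) = (LINT s|lborel. poly_gauss p x s * poly_gauss q y s)"
  by (simp add: PG_def inner_abs_L2)

lemma inner_PG_1: "inner (PG 1 y) (PG 1 x) = sqrt (pi / 2) * exp (- (y - x)\<^sup>2 / 2)"
proof -
  have "poly_gauss 1 y s * poly_gauss 1 x s
      = sqrt (pi / 2) * exp (- (y - x)\<^sup>2 / 2) * normal_density ((x + y) / 2) (1 / 2) s" for s
  proof -
    have "- (s - y)\<^sup>2 + - (s - x)\<^sup>2 = - (y - x)\<^sup>2 / 2 + - 2 * (s - (x + y) / 2)\<^sup>2"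
      by (simp add: power2_eq_square field_simps)
    then have "poly_gauss 1 y s * poly_gauss 1 x s
        = exp (- (y - x)\<^sup>2 / 2) * exp (- 2 * (s - (x + y) / 2)\<^sup>2)"
      by (simp add: poly_gauss_def flip: exp_add)
    moreover have "sqrt (pi / 2) * normal_density ((x + y) / 2) (1 / 2) s
        = exp (- 2 * (s - (x + y) / 2)\<^sup>2)"
      by (simp add: normal_density_def power2_eq_square)
    ultimately show ?thesis by simp
  qed
  then show ?thesis by (simp add: inner_PG_eq)
qed

text \<open>On exp (y^2 / 2) times the integral, the operator g' + (y - a) g multiplies the
  integrand by 2s - a.\<close>

lemma DERIV_inner_PG_node:
  "((\<lambda>y. exp (y\<^sup>2 / 2) * inner (PG 1 y) (PG q 0)) has_real_derivative
     exp (y\<^sup>2 / 2) * inner (PG 1 y) (PG ([:- a, 2:] * q) 0)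
       - (y - a) * (exp (y\<^sup>2 / 2) * inner (PG 1 y) (PG q 0))) (at y)"
proof -
  have int: "integrable lborel (\<lambda>s. poly_gauss 1 y s * poly_gauss r 0 s)" for r
    by (simp add: square_integrable_mult)
  \<comment> \<open>The kernel's derivative brings down 2 (s - y) = (2s - a) + (a - 2y); with the y
    from exp (y^2 / 2), the last part becomes -(y - a).\<close>
  have "inner (PG (gauss_deriv 1) y) (PG q 0)
      = (LINT s|lborel. poly_gauss 1 y s * poly_gauss ([:- a, 2:] * q) 0 s
          + (a - 2 * y) * (poly_gauss 1 y s * poly_gauss q 0 s))"
    unfolding inner_PG_eq
    by (intro Bochner_Integration.integral_cong)
       (simp_all add: poly_gauss_def gauss_deriv_def algebra_simps)
  also have "\<dots> = inner (PG 1 y) (PG ([:- a, 2:] * q) 0) + (a - 2 * y) * inner (PG 1 y) (PG q 0)"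
    unfolding inner_PG_eq by (simp only: Bochner_Integration.integral_add int
        integrable_mult_right integral_mult_right_zero)
  finally have eq: "inner (PG (gauss_deriv 1) y) (PG q 0)
      = inner (PG 1 y) (PG ([:- a, 2:] * q) 0) + (a - 2 * y) * inner (PG 1 y) (PG q 0)" .
  have "((\<lambda>y. exp (y\<^sup>2 / 2)) has_real_derivative exp (y\<^sup>2 / 2) * y) (at y)"
    by (auto intro!: derivative_eq_intros)
  from DERIV_mult[OF this DERIV_inner_PG] show ?thesis
    by (rule DERIV_cong) (simp add: eq algebra_simps del: mult_pCons_left)
qed

text \<open>A zero integral of a nonnegative integrand would make \<open>q\<close> vanish almost
  everywhere, but its roots form a finite null set.\<close>

lemma inner_PG_pos:
  assumes "q \<noteq> 0" "\<And>s. 0 \<le> poly q s"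
  shows "0 < inner (PG 1 y) (PG q 0)"
proof -
  let ?f = "\<lambda>s. poly_gauss 1 y s * poly_gauss q 0 s"
  have f: "integrable lborel ?f" "AE s in lborel. 0 \<le> ?f s"
    using assms(2) by (simp_all add: square_integrable_mult, simp add: poly_gauss_def)
  have "(LINT s|lborel. ?f s) \<noteq> 0"
  proof
    assume "(LINT s|lborel. ?f s) = 0"
    then have zero: "AE s in lborel. poly q s = 0"
      using integral_nonneg_eq_0_iff_AE[OF f] by (simp add: poly_gauss_def)
    have "AE s in lborel. s \<notin> {s. poly q s = 0}"
      using poly_roots_finite[OF \<open>q \<noteq> 0\<close>] by (intro AE_not_in finite_imp_null_set_lborel)
    with zero have "AE s in (lborel :: real measure). False" by (auto elim: eventually_elim2)
    then show False by (simp add: trivial_limit_def[symmetric] ae_filter_eq_bot_iff)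
  qed
  moreover have "0 \<le> (LINT s|lborel. ?f s)"
    using f(2) by (rule integral_nonneg_AE)
  ultimately show ?thesis unfolding inner_PG_eq by linarith
qed

text \<open>The common core of both conditions: \<open>eta_V\<close> is the case of \<open>M\<close>
  nodes with \<open>m i = 2\<close>, \<open>eta_W\<close> that of one node with multiplicity
  \<open>2 * M\<close>.\<close>

lemma gaussian_interpolation_certificate:
  fixes x :: "'i \<Rightarrow> real" and q :: "'i \<Rightarrow> real poly" and e :: "nat \<Rightarrow> real \<Rightarrow> real"
  assumes "finite I" "inj_on x I"
    and m: "\<And>i. i \<in> I \<Longrightarrow> even (m i)" "\<And>i. i \<in> I \<Longrightarrow> degree (q i) < m i"
    and e0: "\<And>y. e 0 y = (\<Sum>i\<in>I. poly (q i) y * exp (- (y - x i)\<^sup>2 / 2))"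
    and e: "\<And>k y. (e k has_real_derivative e (Suc k) y) (at y)"
    and one: "\<And>i. i \<in> I \<Longrightarrow> e 0 (x i) = 1"
    and zero: "\<And>i k. i \<in> I \<Longrightarrow> 0 < k \<Longrightarrow> k < m i \<Longrightarrow> e k (x i) = 0"
    and lim: "(e 0 \<longlongrightarrow> 0) at_top"
  shows "(\<forall>y. y \<notin> x ` I \<longrightarrow> e 0 y < 1) \<and> (\<forall>i\<in>I. e (m i) (x i) < 0)"
proof -
  obtain "is" where "is": "set is = I" "distinct is"
    using finite_distinct_list \<open>finite I\<close> by metis
  define as where "as = node_list m x is"
  define n where "n = length as"
  have n: "n = sum m I"
    using "is" by (simp add: n_def as_def length_node_list sum_list_distinct_conv_sum_set)
  define p where "p = (\<lambda>k. prod_list (map (\<lambda>a. [:- a, 2:]) (take k as)))"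
  define r where "r = (\<lambda>k i. foldl (shift_deriv (x i)) (q i) (take k as))"
  \<comment> \<open>The result of the first \<open>k\<close> operators on 1 - \<open>e 0\<close>. By
    \<open>inner_PG_1\<close> with center 0, the first term equals 1 for k = 0.\<close>
  define g where "g = (\<lambda>k y. 1 / sqrt (pi / 2) * (exp (y\<^sup>2 / 2) * inner (PG 1 y) (PG (p k) 0))
    - (\<Sum>i\<in>I. poly (r k i) y * exp (- (y - x i)\<^sup>2 / 2)))"
  define d where "d = (\<lambda>k y. (if k = 0 then 1 else 0) - e k y)"
  have g: "(g k has_real_derivative g (Suc k) y - (y - as ! k) * g k y) (at y)" if "k < n" for k y
  proof -
    have pS: "p (Suc k) = [:- (as ! k), 2:] * p k"
      using that by (simp add: p_def n_def take_Suc_conv_app_nth mult.commute del: mult_pCons_left mult_pCons_right)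
    have rS: "r (Suc k) i = shift_deriv (x i) (r k i) (as ! k)" for i
      using that by (simp add: r_def n_def take_Suc_conv_app_nth)
    have "(g k has_real_derivative
      1 / sqrt (pi / 2) * (exp (y\<^sup>2 / 2) * inner (PG 1 y) (PG ([:- (as ! k), 2:] * p k) 0)
       - (y - as ! k) * (exp (y\<^sup>2 / 2) * inner (PG 1 y) (PG (p k) 0)))
      - (\<Sum>i\<in>I. poly (shift_deriv (x i) (r k i) (as ! k)) y * exp (- (y - x i)\<^sup>2 / 2)
         - (y - as ! k) * (poly (r k i) y * exp (- (y - x i)\<^sup>2 / 2)))) (at y)"
      unfolding g_def by (intro DERIV_diff DERIV_cmult DERIV_inner_PG_node DERIV_sum DERIV_poly_exp)
    then show ?thesis
      by (rule DERIV_cong) (simp add: g_def pS rS sum_subtractf right_diff_distrib sum_distrib_left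
          mult.left_commute del: mult_pCons_left)
  qed
  have g0: "g 0 = d 0"
    by (auto simp: g_def d_def p_def r_def e0 inner_PG_1 simp flip: exp_add)
  have d: "(d k has_real_derivative d (Suc k) y) (at y)" for k y
    unfolding d_def by (auto intro!: derivative_eq_intros e)
  have d_zero: "d k (x i) = 0" if "i \<in> I" "k < m i" for i k
    using one zero that by (simp add: d_def)
  \<comment> \<open>Each node occurs more often than the degree of its polynomial, so all Gaussian
    terms are gone; \<open>p n\<close> is a product of even powers.\<close>
  have "g n y > 0" for y
  proof -
    have "r n i = 0" if "i \<in> I" for i
      using filter_node_list[of i "is" m x] m(2)[OF that] that "is"
      unfolding r_def n_def take_all[OF order_refl] by (intro foldl_shift_deriv_eq_0) (simp add: as_def)
    moreover have "0 < inner (PG 1 y) (PG (p n) 0)"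
    proof (rule inner_PG_pos)
      show "p n \<noteq> 0" by (auto simp: p_def prod_list_zero_iff)
      have "p n = (\<Prod>i\<leftarrow>is. [:- x i, 2:] ^ m i)"
        by (simp only: p_def n_def take_all[OF order_refl] as_def prod_node_list)
      moreover have "0 \<le> poly (\<Prod>i\<leftarrow>js. [:- x i, 2:] ^ m i) s" if "set js \<subseteq> I" for js s
        using that by (induction js) (auto simp: poly_mult poly_power m(1) zero_le_even_power
            simp del: mult_pCons_left intro!: mult_nonneg_nonneg)
      ultimately show "0 \<le> poly (p n) s" for s using "is" by simp
    qed
    ultimately show ?thesis by (simp add: g_def)
  qed
  then have g_last: "g n y \<noteq> 0" for y by (metis less_irrefl)
  \<comment> \<open>The cap \<open>Suc n\<close> keeps every index below \<open>k z\<close> within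
    the range 0..n of the recursion, while leaving room to raise one node's multiplicity by
    one.\<close>
  have few_zeros: "sum k A \<le> n" if fA: "finite A" and kA: "\<And>z. z \<in> A \<Longrightarrow> 0 < k z \<and> k z \<le> Suc n"
    and kz: "\<And>z i. z \<in> A \<Longrightarrow> i < k z \<Longrightarrow> d i z = 0" for A and k :: "real \<Rightarrow> nat"
  proof (rule ccontr)
    assume "\<not> sum k A \<le> n"
    have "g i z = 0" if z: "z \<in> A" "i < k z" for i z
    proof -
      have "i \<le> n" using z kA[of z] by fastforce
      then obtain c :: "nat \<Rightarrow> real poly" where "g i z = d i z + (\<Sum>j<i. poly (c j) z * d j z)"
        using derivs_of_recursion[of n g "\<lambda>k. as ! k" d i, OF g d g0] by blast
      then show ?thesis using z kz by simp
    qed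
    then have "\<exists>z. g n z = 0"
      using zero_of_last[of n g "\<lambda>k. as ! k" A k, OF g] fA kA \<open>\<not> sum k A \<le> n\<close> by force
    with g_last show False by blast
  qed
  define mm where "mm = (\<lambda>z. m (the_inv_into I x z))"
  have mm: "mm (x i) = m i" if "i \<in> I" for i
    using that \<open>inj_on x I\<close> by (simp add: mm_def the_inv_into_f_f)
  have sum_mm: "sum mm (x ` I) = n"
    using \<open>inj_on x I\<close> mm by (simp add: sum.reindex n)
  have m_le: "m i \<le> n" if "i \<in> I" for i
    using member_le_sum[of i I m] that \<open>finite I\<close> by (simp add: n)
  have m_pos: "0 < m i" if "i \<in> I" for i using m(2)[OF that] by simp
  \<comment> \<open>The nodes already use up all \<open>n\<close> zeros; a further one, here or as
    an extra order at a node below, would give n + 1.\<close>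
  have off: "d 0 y \<noteq> 0" if "y \<notin> x ` I" for y
  proof
    assume "d 0 y = 0"
    have "sum (mm(y := 1)) (insert y (x ` I)) \<le> n"
      by (rule few_zeros)
         (use \<open>finite I\<close> \<open>d 0 y = 0\<close> that m_pos m_le d_zero in
          \<open>auto simp: mm le_SucI split: if_splits\<close>)
    moreover have "sum (mm(y := 1)) (x ` I) = sum mm (x ` I)"
      using that by (intro sum.cong) auto
    ultimately show False using that \<open>finite I\<close> sum_mm by simp
  qed
  have on: "d (m i) (x i) \<noteq> 0" if i: "i \<in> I" for i
  proof
    assume "d (m i) (x i) = 0"
    let ?k = "mm(x i := Suc (m i))"
    have "sum ?k (x ` I) \<le> n"
    proof (rule few_zeros)
      show "d k z = 0" if "z \<in> x ` I" "k < ?k z" for z k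
        using that i \<open>d (m i) (x i) = 0\<close> d_zero mm
        by (auto simp: less_Suc_eq split: if_splits)
    qed (use \<open>finite I\<close> i m_pos m_le in \<open>auto simp: mm le_SucI\<close>)
    moreover have "sum ?k (x ` I) = Suc (sum mm (x ` I))"
      using i \<open>finite I\<close> mm by (simp add: sum.remove[of "x ` I" "x i"])
    ultimately show False using sum_mm by simp
  qed
  have "\<forall>\<^sub>F y in at_top. 0 < d 0 y"
    using order_tendstoD(2)[OF lim, of 1] by (simp add: d_def)
  note * = nonneg_of_even_zeros[of d, OF d _ this]
  have nonneg: "0 \<le> d 0 y" for y
  proof (rule *)
    fix z assume "d 0 z = 0"
    with off obtain i where "i \<in> I" "z = x i" by blast
    then show "\<exists>m>0. even m \<and> (\<forall>k<m. d k z = 0) \<and> d m z \<noteq> 0"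
      using d_zero m_pos m(1) on by (intro exI[of _ "m i"]) auto
  qed
  have "e (m i) (x i) < 0" if i: "i \<in> I" for i
  proof -
    \<comment> \<open>A negative value would make \<open>d 0\<close> negative around the node,
      against \<open>nonneg\<close>.\<close>
    have "0 < d (m i) (x i)"
    proof (rule ccontr)
      assume "\<not> 0 < d (m i) (x i)"
      then have "\<forall>\<^sub>F y in at (x i). 0 < - d 0 y"
        using on[OF i] m_pos[OF i] m(1)[OF i] d_zero[OF i]
        by (intro even_order_zero_pos[of "\<lambda>k y. - d k y" "m i"])
           (auto intro!: derivative_eq_intros d)
      then obtain y where "0 < - d 0 y" using eventually_happens by fastforce
      with nonneg[of y] show False by simp
    qed
    then show ?thesis using m_pos[OF i] by (simp add: d_def)
  qed
  moreover have "e 0 y < 1" if "y \<notin> x ` I" for y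
    using nonneg[of y] off[OF that] by (simp add: d_def)
  ultimately show ?thesis by blast
qed

subsection \<open>The two non-degeneracy conditions\<close>

text \<open>The probabilists' Hermite polynomials, matching the Gaussian exp (-u^2 / 2) produced by
  inner products of two kernels.\<close>

primrec hermite :: "nat \<Rightarrow> real poly" where
  "hermite 0 = 1"
| "hermite (Suc k) = pCons 0 (hermite k) - pderiv (hermite k)"

lemma degree_hermite [simp]: "degree (hermite k) = k"
  and coeff_hermite [simp]: "coeff (hermite k) k = 1"
proof (induction k)
  case (Suc k)
  {
    case 2
    then show ?case using Suc by (simp add: coeff_pderiv coeff_eq_0)
  next
    case 1
    have "coeff (hermite (Suc k)) (Suc k) \<noteq> 0"
      using Suc by (simp add: coeff_pderiv coeff_eq_0)
    moreover have "degree (hermite (Suc k)) \<le> Suc k"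
      using Suc by (auto intro!: degree_diff_le simp: degree_pderiv degree_pCons_eq_if)
    ultimately show ?case by (meson le_antisym le_degree)
  }
qed simp_all

text \<open>The k-th polynomial is monic of degree k, so top coefficients can be compared one by
  one.\<close>

lemma hermite_independent:
  assumes "(\<Sum>k<n. smult (b k) (hermite k)) = 0" "k < n"
  shows "b k = 0"
  using assms
proof (induction n)
  case (Suc n)
  have "coeff (\<Sum>k<n. smult (b k) (hermite k)) n = 0"
    by (simp add: coeff_sum coeff_eq_0)
  moreover have "coeff (\<Sum>k<Suc n. smult (b k) (hermite k)) n = 0" using Suc.prems(1) by simp
  ultimately have "b n = 0" by simp
  with Suc show ?case by (cases "k = n") auto
qed simp

text \<open>Differentiating \<open>inner_PG_1\<close> in the center \<open>x\<close>; each
  derivative reproduces the Hermite recursion.\<close>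

lemma inner_PG_iter:
  "inner (PG 1 y) (PG ((gauss_deriv ^^ k) 1) x)
     = sqrt (pi / 2) * (poly (hermite k) (y - x) * exp (- (y - x)\<^sup>2 / 2))"
proof (induction k arbitrary: x)
  case 0
  then show ?case by (simp add: inner_PG_1)
next
  case (Suc k)
  let ?q = "hermite k" and ?E = "exp (- (y - x)\<^sup>2 / 2)"
  have y: "((\<lambda>x. y - x) has_real_derivative - 1) (at x)" by (auto intro!: derivative_eq_intros)
  have E: "((\<lambda>x. exp (- (y - x)\<^sup>2 / 2)) has_real_derivative ?E * (y - x)) (at x)"
    by (auto intro!: derivative_eq_intros simp: field_simps)
  have "((\<lambda>x. inner (PG ((gauss_deriv ^^ k) 1) x) (PG 1 y)) has_real_derivative
      sqrt (pi / 2) * (poly (pderiv ?q) (y - x) * - 1 * ?E + ?E * (y - x) * poly ?q (y - x))) (at x)"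
    unfolding inner_commute[of _ "PG 1 y"] Suc
    by (intro DERIV_cmult DERIV_mult DERIV_chain2[OF poly_DERIV y] E)
  then have "inner (PG ((gauss_deriv ^^ Suc k) 1) x) (PG 1 y)
      = sqrt (pi / 2) * (poly (pderiv ?q) (y - x) * - 1 * ?E + ?E * (y - x) * poly ?q (y - x))"
    using DERIV_unique[OF DERIV_inner_PG] by simp
  then show ?case by (simp add: inner_commute algebra_simps)
qed

lemma Phi_adj_tendsto_0: "(Phi_adj (framework gaussian) p \<longlongrightarrow> 0) at_top"
  using inner_PG_tendsto_0[of 1 p] by (simp add: Phi_adj_def[abs_def] framework_gaussian)

section \<open>Combinations of kernel derivatives at the nodes\<close>

definition jet :: "(real \<Rightarrow> 'h::real_inner) \<Rightarrow> (nat \<Rightarrow> real) \<Rightarrow> nat \<times> nat \<Rightarrow> 'h" where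
  "jet \<phi> x = (\<lambda>(i, k). iter_deriv k \<phi> (x i))"

text \<open>The polynomial factor of exp (-(y - z)^2 / 2) in the image under \<open>Phi_adj\<close>
  of a combination of derivatives at \<open>z\<close>.\<close>

definition jet_poly :: "nat \<Rightarrow> real \<Rightarrow> (nat \<Rightarrow> real) \<Rightarrow> real poly" where
  "jet_poly n z c = smult (sqrt (pi / 2)) ((\<Sum>k<n. smult (c k) (hermite k)) \<circ>\<^sub>p [:- z, 1:])"

lemma degree_jet_poly:
  assumes "0 < n"
  shows "degree (jet_poly n z c) < n"
proof -
  have "degree (\<Sum>k<n. smult (c k) (hermite k)) < n"
    using assms by (intro degree_sum_less) (auto intro: le_less_trans[OF degree_smult_le])
  then show ?thesis by (simp add: jet_poly_def degree_pcompose)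
qed

lemma jet_poly_eq_0:
  assumes "jet_poly n z c = 0" "k < n"
  shows "c k = 0"
proof -
  have "(\<Sum>k<n. smult (c k) (hermite k)) = 0"
    using assms(1) pcompose_eq_0[of "\<Sum>k<n. smult (c k) (hermite k)" "[:- z, 1:]"]
    by (simp add: jet_poly_def)
  then show ?thesis using hermite_independent assms(2) by blast
qed

lemma Phi_adj_jet_sum:
  fixes I :: "nat set"
  assumes "finite I"
  shows "Phi_adj (framework gaussian) (\<Sum>j\<in>Sigma I (\<lambda>i. {..<m i}). b j *\<^sub>R jet (framework gaussian) x j) y
    = (\<Sum>i\<in>I. poly (jet_poly (m i) (x i) (\<lambda>k. b (i, k))) y * exp (- (y - x i)\<^sup>2 / 2))"
proof -
  have "Phi_adj (framework gaussian) (\<Sum>j\<in>Sigma I (\<lambda>i. {..<m i}). b j *\<^sub>R jet (framework gaussian) x j) y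
    = (\<Sum>(i, k)\<in>Sigma I (\<lambda>i. {..<m i}).
         b (i, k) * (sqrt (pi / 2) * (poly (hermite k) (y - x i) * exp (- (y - x i)\<^sup>2 / 2))))"
    unfolding Phi_adj_def framework_gaussian[of y] inner_sum_right
    by (intro sum.cong) (auto simp: jet_def iter_deriv_framework inner_PG_iter)
  also have "\<dots> = (\<Sum>i\<in>I. \<Sum>k<m i.
         b (i, k) * (sqrt (pi / 2) * (poly (hermite k) (y - x i) * exp (- (y - x i)\<^sup>2 / 2))))"
    using assms by (intro sum.Sigma[symmetric]) auto
  also have "\<dots> = (\<Sum>i\<in>I. poly (jet_poly (m i) (x i) (\<lambda>k. b (i, k))) y * exp (- (y - x i)\<^sup>2 / 2))"
    by (intro sum.cong refl)
       (simp add: jet_poly_def poly_sum poly_pcompose sum_distrib_left sum_distrib_right mult_ac)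
  finally show ?thesis .
qed

text \<open>Applying \<open>Phi_adj\<close> to a vanishing combination gives a vanishing sum of
  Gaussian terms; their independence kills each polynomial, and then Hermite independence each
  coefficient.\<close>

lemma jet_independent:
  assumes "finite I" "inj_on x I"
    and "(\<Sum>j\<in>Sigma I (\<lambda>i. {..<m i}). b j *\<^sub>R jet (framework gaussian) x j) = 0"
    and "j \<in> Sigma I (\<lambda>i. {..<m i})"
  shows "b j = 0"
proof -
  obtain i k where j: "j = (i, k)" "i \<in> I" "k < m i" using assms(4) by auto
  have "(\<Sum>i\<in>I. poly (jet_poly (m i) (x i) (\<lambda>k. b (i, k))) y * exp (- (y - x i)\<^sup>2 / 2)) = 0" for y
    unfolding Phi_adj_jet_sum[OF assms(1), symmetric] assms(3) by (simp add: Phi_adj_def)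
  from gaussian_combination_independent[OF assms(1,2) this j(2)] j(3)
  have "b (i, k) = 0" by (rule jet_poly_eq_0)
  then show ?thesis by (simp add: j)
qed

text \<open>Independence applied to a difference, in the double-sum form shared by
  \<open>Gamma\<close> and \<open>F_map\<close>.\<close>

lemma jet_sum_inj:
  fixes I :: "nat set" and x :: "nat \<Rightarrow> real"
  assumes "finite I" "inj_on x I" "i \<in> I" "k < m i"
    and "(\<Sum>i\<in>I. \<Sum>k<m i. b i k *\<^sub>R iter_deriv k (framework gaussian) (x i))
       = (\<Sum>i\<in>I. \<Sum>k<m i. b' i k *\<^sub>R iter_deriv k (framework gaussian) (x i))"
  shows "b i k = b' i k"
proof -
  define c where "c = (\<lambda>(i, k). b i k - b' i k)"
  have "(\<Sum>j\<in>Sigma I (\<lambda>i. {..<m i}). c j *\<^sub>R jet (framework gaussian) x j)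
    = (\<Sum>(i, k)\<in>Sigma I (\<lambda>i. {..<m i}). (b i k - b' i k) *\<^sub>R iter_deriv k (framework gaussian) (x i))"
    by (intro sum.cong) (auto simp: c_def jet_def)
  also have "\<dots> = (\<Sum>i\<in>I. \<Sum>k<m i. (b i k - b' i k) *\<^sub>R iter_deriv k (framework gaussian) (x i))"
    using assms(1) by (intro sum.Sigma[symmetric]) auto
  also have "\<dots> = 0"
    using assms(5) by (simp add: scaleR_diff_left sum_subtractf)
  finally have "c (i, k) = 0"
    using assms(1-4) by (intro jet_independent[where j = "(i, k)"]) auto
  then show ?thesis by (simp add: c_def)
qed

text \<open>The constraints prescribe inner products with the independent jets, so the minimal norm
  element lies in their span and its image under \<open>Phi_adj\<close> is a Gaussian
  combination.\<close>

lemma min_norm_certificate: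
  fixes I :: "nat set" and m :: "nat \<Rightarrow> nat"
  assumes I: "finite I" "inj_on x I" and m: "\<And>i. i \<in> I \<Longrightarrow> even (m i) \<and> 0 < m i"
  defines "\<eta> \<equiv> Phi_adj (framework gaussian) (min_norm_elt
    {p. \<forall>i\<in>I. \<forall>k<m i. (deriv ^^ k) (Phi_adj (framework gaussian) p) (x i) = (if k = 0 then 1 else 0)})"
  shows "(\<forall>y. y \<notin> x ` I \<longrightarrow> \<eta> y < 1) \<and> (\<forall>i\<in>I. (deriv ^^ m i) \<eta> (x i) < 0)"
proof -
  let ?J = "Sigma I (\<lambda>i. {..<m i})"
  let ?v = "jet (framework gaussian) x"
  let ?c = "\<lambda>(i, k). if k = 0 then 1 else 0 :: real"
  have "finite ?J" using I by auto
  have indep: "\<forall>j\<in>?J. b j = 0" if "(\<Sum>j\<in>?J. b j *\<^sub>R ?v j) = 0" for b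
    using jet_independent[OF I that] by blast
  have "\<exists>b. \<forall>j\<in>?J. inner (?v j) (\<Sum>j\<in>?J. b j *\<^sub>R ?v j) = ?c j"
    by (rule independent_family_interpolation[OF \<open>finite ?J\<close>]) (rule indep)
  then obtain b where b: "\<forall>j\<in>?J. inner (?v j) (\<Sum>j\<in>?J. b j *\<^sub>R ?v j) = ?c j" ..
  define p where "p = (\<Sum>j\<in>?J. b j *\<^sub>R ?v j)"
  define e where "e = (\<lambda>k. (deriv ^^ k) (Phi_adj (framework gaussian) p))"
  have jet: "inner (?v (i, k)) q = (deriv ^^ k) (Phi_adj (framework gaussian) q) (x i)" for i k q
    by (simp add: jet_def deriv_iter_Phi_adj iter_deriv_framework)
  have "{p. \<forall>i\<in>I. \<forall>k<m i. (deriv ^^ k) (Phi_adj (framework gaussian) p) (x i) = (if k = 0 then 1 else 0)}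
      = {q. \<forall>j\<in>?J. inner (?v j) q = ?c j}"
    by (auto simp: jet)
  then have eta: "\<eta> = e 0"
    using min_norm_elt_interpolation[OF p_def, of ?c] b by (simp add: \<eta>_def e_def p_def)
  have ei: "e k (x i) = (if k = 0 then 1 else 0)" if "i \<in> I" "k < m i" for i k
    using bspec[OF b, of "(i, k)"] that by (simp add: jet e_def p_def)
  have "(\<forall>y. y \<notin> x ` I \<longrightarrow> e 0 y < 1) \<and> (\<forall>i\<in>I. e (m i) (x i) < 0)"
  proof (rule gaussian_interpolation_certificate[OF I,
        where q = "\<lambda>i. jet_poly (m i) (x i) (\<lambda>k. b (i, k))"])
    show "e 0 y = (\<Sum>i\<in>I. poly (jet_poly (m i) (x i) (\<lambda>k. b (i, k))) y * exp (- (y - x i)\<^sup>2 / 2))" for y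
      using Phi_adj_jet_sum[OF I(1), where b = b] by (simp add: e_def p_def)
    show "(e k has_real_derivative e (Suc k) y) (at y)" for k y
      unfolding e_def deriv_iter_Phi_adj using DERIV_inner_PG by simp
    show "(e 0 \<longlongrightarrow> 0) at_top" using Phi_adj_tendsto_0 by (simp add: e_def)
  qed (use m ei in \<open>auto intro: degree_jet_poly\<close>)
  then show ?thesis by (simp only: eta) (simp add: e_def)
qed

section \<open>Verification for the Gaussian kernel\<close>

lemma nondegenerate_support_gaussian:
  assumes "strict_mono_on {1..M} x"
  shows "nondegenerate_support (framework gaussian) M x"
proof -
  have inj: "inj_on x {1..M}" by (rule strict_mono_on_imp_inj_on[OF assms])
  have Gamma: "Gamma (framework gaussian) M x b
    = (\<Sum>i\<in>{1..M}. \<Sum>k<2. b (2 * i - 1 + k) *\<^sub>R iter_deriv k (framework gaussian) (x i))" for b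
    unfolding Gamma_def by (intro sum.cong refl) (simp add: numeral_2_eq_2 iter_deriv_def)
  have "inj_on (Gamma (framework gaussian) M x) (Rn (2 * M))"
  proof (rule inj_onI)
    fix b b' assume "b \<in> Rn (2 * M)" "b' \<in> Rn (2 * M)"
      and "Gamma (framework gaussian) M x b = Gamma (framework gaussian) M x b'"
    then have "b (2 * i - 1 + k) = b' (2 * i - 1 + k)" if "i \<in> {1..M}" "k < 2" for i k
      using that unfolding Gamma by (intro jet_sum_inj[OF _ inj, where m = "\<lambda>i. 2"]) auto
    \<comment> \<open>The coordinates 2i - 1 and 2i belong to node \<open>i\<close>; quotient and
      remainder of j + 1 by 2 recover \<open>i\<close> and the order \<open>k\<close>.\<close>
    moreover have "\<exists>i\<in>{1..M}. \<exists>k<2. j = 2 * i - 1 + k" if "j \<in> {1..2 * M}" for j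
      using that by (intro bexI[of _ "(j + 1) div 2"] exI[of _ "(j + 1) mod 2"]) (simp_all only: atLeastAtMost_iff, presburger+)
    ultimately have "b j = b' j" if "j \<in> {1..2 * M}" for j using that by metis
    with \<open>b \<in> _\<close> \<open>b' \<in> _\<close> show "b = b'" unfolding Rn_def by (intro PiE_ext) auto
  qed
  moreover have "eta_V (framework gaussian) M x = Phi_adj (framework gaussian) (min_norm_elt
    {p. \<forall>i\<in>{1..M}. \<forall>k<2. (deriv ^^ k) (Phi_adj (framework gaussian) p) (x i) = (if k = 0 then 1 else 0)})"
    unfolding eta_V_def p_V_def by (simp add: numeral_2_eq_2 All_less_Suc2)
  ultimately show ?thesis
    unfolding nondegenerate_support_def
    using min_norm_certificate[OF _ inj, of "\<lambda>i. 2"] by simp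
qed

lemma nondegenerate_point_gaussian:
  assumes "1 \<le> M"
  shows "nondegenerate_point (framework gaussian) M z"
proof -
  \<comment> \<open>The single point is a family of nodes indexed by {0}.\<close>
  have inj: "inj_on (\<lambda>_. z) {0 :: nat}" by simp
  have F: "F_map (framework gaussian) (2 * M - 1) z b
    = (\<Sum>i\<in>{0 :: nat}. \<Sum>k<2 * M. b (k + 1) *\<^sub>R iter_deriv k (framework gaussian) z)" for b
    unfolding F_map_def using assms by (auto intro!: sum.cong)
  have "inj_on (F_map (framework gaussian) (2 * M - 1) z) (Rn (2 * M))"
  proof (rule inj_onI)
    fix b b' assume "b \<in> Rn (2 * M)" "b' \<in> Rn (2 * M)"
      and "F_map (framework gaussian) (2 * M - 1) z b = F_map (framework gaussian) (2 * M - 1) z b'"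
    then have "b (k + 1) = b' (k + 1)" if "k < 2 * M" for k
      using that jet_sum_inj[OF _ inj, of 0 k "\<lambda>i. 2 * M" "\<lambda>i k. b (k + 1)" "\<lambda>i k. b' (k + 1)"]
      unfolding F by simp
    then have "b j = b' j" if "j \<in> {1..2 * M}" for j
      using that by (cases j) auto
    with \<open>b \<in> _\<close> \<open>b' \<in> _\<close> show "b = b'" unfolding Rn_def by (intro PiE_ext) auto
  qed
  moreover have "eta_W (framework gaussian) M z = Phi_adj (framework gaussian) (min_norm_elt
    {p. \<forall>i\<in>{0 :: nat}. \<forall>k<2 * M. (deriv ^^ k) (Phi_adj (framework gaussian) p) z = (if k = 0 then 1 else 0)})"
  proof -
    \<comment> \<open>As \<open>M\<close> is positive, 2M - 1 is not truncated, and orders 0 and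
      1..2M - 1 together are exactly those below 2M.\<close>
    have "(Phi_adj (framework gaussian) p z = 1 \<and>
        (\<forall>k\<in>{1..2 * M - 1}. (deriv ^^ k) (Phi_adj (framework gaussian) p) z = 0)) \<longleftrightarrow>
      (\<forall>k<2 * M. (deriv ^^ k) (Phi_adj (framework gaussian) p) z = (if k = 0 then 1 else 0))" for p
      using assms by (auto simp: Suc_le_eq)
    then show ?thesis unfolding eta_W_def p_W_def by simp
  qed
  ultimately show ?thesis
    unfolding nondegenerate_point_def
    using min_norm_certificate[OF _ inj, of "\<lambda>i. 2 * M"] assms framework_K_k by simp
qed

theorem proposition3:
  fixes M :: nat
  assumes "1 \<le> M"
  shows "(\<forall>(a :: nat \<Rightarrow> real) (x :: nat \<Rightarrow> real).
            strict_mono_on {1..M} x \<and> (\<forall>i\<in>{1..M}. 0 < a i) \<longrightarrow>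
              NDSC (framework gaussian) (spikes M a x)) \<and>
         (\<forall>x0 :: real. nondegenerate_point (framework gaussian) M x0)"
  using assms NDSC_spikes_iff nondegenerate_support_gaussian nondegenerate_point_gaussian by blast

end
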